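(* Let $D\subseteq\mathbb{R}^l$ be non-empty, $U\subseteq\mathbb{R}^m$, and let $f:D\times\mathbb{R}^n\times U\to\mathbb{R}^n$ satisfy the standing assumptions (H1) and (H2) listed in the context. Consider the control system $\dot x(t)=f(d(t),x(t),u(t))$ with $d(t)\in D$, $x(t)\in\mathbb{R}^n$, $u(t)\in U$. Suppose that the following two conditions hold. (P1) There exist a locally bounded mapping $\tilde k:\mathbb{R}^n\to U$ with $\tilde k(0)=0$, a bounded open set $\Theta\subseteq\mathbb{R}^n$ which contains a neighborhood of $0\in\mathbb{R}^n$, a function $\gamma\in K_\infty$ with $|f(d,z,\tilde k(x))|\le\gamma(|z|+|x|)$ for all $(d,z,x)\in D\times\mathbb{R}^n\times\mathbb{R}^n$, a constant $\tilde h>0$ and a function $\sigma\in KL$ such that for every $x_0\in\Theta$, every $d\in L^\infty_{loc}(\mathbb{R}^+;D)$, every measurable, locally bounded $\bar d:\mathbb{R}^+\to\mathbb{R}^+$ and every $t\ge 0$, $$|x(t)|\le\sigma(|x_0|,t),\qquad x(t)\in\Theta,$$ where $x(t)$ denotes the solution of the sampled-data system $$\dot x(t)=f(d(t),x(t),\tilde k(x(\tau_i))),\ t\in[\tau_i,\tau_{i+1}),\qquad \tau_0=0,\ \tau_{i+1}=\tau_i+\tilde h\exp(-\bar d(\tau_i)),\ i=0,1,\dots$$ with initial condition $x(0)=x_0$. (P2) There exist a constant $r>0$, an integer $N$ and sets $\Omega_j\subseteq\mathbb{R}^n$, $j=1,\dots,N$, with $\Omega_1=\Theta$ and $\bigcup_{j=1}^N\Omega_j=\mathbb{R}^n$,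 such that for each $j\in\{2,\dots,N\}$ the set $\bigcup_{i=1}^{j-1}\Omega_i$ is $r$-robustly reachable from $\Omega_j$ for the system $\dot x=f(d,x,u)$ with constant control. Then the equilibrium point $0\in\mathbb{R}^n$ of $\dot x=f(d,x,u)$ is robustly globally stabilizable by means of bounded sampled-data control with positive sampling rate.
   Context: Notation. $\mathbb{R}^+=[0,+\infty)$; $|\cdot|$ is the Euclidean norm; $x'$ is the transpose of $x$. $L^\infty_{loc}(\mathbb{R}^+;D)$ is the class of Lebesgue measurable, locally essentially bounded maps $d:\mathbb{R}^+\to D$. Class $N$: non-decreasing continuous $\gamma:\mathbb{R}^+\to\mathbb{R}^+$ with $\gamma(0)=0$. Class $K$: continuous strictly increasing $\gamma:\mathbb{R}^+\to\mathbb{R}^+$ with $\gamma(0)=0$; $K_\infty$: unbounded functions of class $K$. Class $KL$: continuous $\sigma:\mathbb{R}^+\times\mathbb{R}^+\to\mathbb{R}^+$ such that $\sigma(\cdot,t)$ is of class $K$ for each $t\ge0$, and for each $s\ge0$ the map $\sigma(s,\cdot)$ is non-increasing with $\lim_{t\to+\infty}\sigma(s,t)=0$. Standing assumptions. (H1) $f$ is continuous on $D\times\mathbb{R}^n\times U$ and for every bounded $S\subset\mathbb{R}^n\times U$ there exists $L\ge0$ such that $(x-y)'(f(d,x,u)-f(d,y,u))\le L|x-y|^2$ for all $d\in D$ and all $(x,u)\in S$, $(y,u)\in S$. (H2) There exists $a\in K_\infty$ such that $|f(d,x,u)|\le a(|x|+|u|)$ for all $(u,d,x)\in U\times D\times\mathbb{R}^n$.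 Solutions are absolutely continuous functions satisfying the differential equation almost everywhere. A solution of a sampled-data system $\dot x(t)=f(d(t),x(t),k(x(\tau_i)))$, $t\in[\tau_i,\tau_{i+1})$, $\tau_0=0$, $\tau_{i+1}=\tau_i+h\exp(-\tilde d(\tau_i))$, is built step by step: given $\tau_i$ and $x(\tau_i)$, compute $\tau_{i+1}$, solve the differential equation on $[\tau_i,\tau_{i+1})$ with the control held constant at $k(x(\tau_i))$, and set $x(\tau_{i+1})=\lim_{t\to\tau_{i+1}^-}x(t)$. Robust reachability. Let $r>0$. A set $A\subseteq\mathbb{R}^n$ is $r$-robustly reachable from a set $\Omega\subseteq\mathbb{R}^n$ for $\dot x=f(d,x,u)$ with constant control if there exist $v\in U$, $c\ge0$ and functions $a,b\in N$ such that: for every $x_0\in\Omega$ and $d\in L^\infty_{loc}(\mathbb{R}^+;D)$ there exists $T(d,x_0)\in[0,c+b(|x_0|)]$ such that the solution $x(t)$ of $\dot x=f(d,x,u)$ with $u(t)\equiv v$ and $x(0)=x_0$ exists for all $t\in[0,T(d,x_0)+r]$ and satisfies: (i) $|x(t)|\le a(|x_0|)$ for all $t\in[0,T(d,x_0)+r]$; (ii) $x(t)\in A$ for all $t\in[T(d,x_0),T(d,x_0)+r]$; (iii) $x(t)\in\Omega$ for all $t\in[0,T(d,x_0)]$. Robust global stabilizability. The equilibrium point $0$ of $\dot x=f(d,x,u)$ is robustly globally stabilizable by means of sampled-data control with positive sampling rate if there exist a locally bounded mapping $k:\mathbb{R}^n\to U$ with $k(0)=0$, a function $\kappa\in K_\infty$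 with $|f(d,z,k(x))|\le\kappa(|z|+|x|)$ for all $(d,z,x)\in D\times\mathbb{R}^n\times\mathbb{R}^n$, a constant $h>0$ and a function $\sigma\in KL$ such that for all $x_0\in\mathbb{R}^n$, all $d\in L^\infty_{loc}(\mathbb{R}^+;D)$, all measurable, locally bounded $\tilde d:\mathbb{R}^+\to\mathbb{R}^+$ and all $t\ge0$ one has $|x(t)|\le\sigma(|x_0|,t)$, where $x(t)$ is the solution of $\dot x(t)=f(d(t),x(t),k(x(\tau_i)))$, $t\in[\tau_i,\tau_{i+1})$, $\tau_0=0$, $\tau_{i+1}=\tau_i+h\exp(-\tilde d(\tau_i))$, $i=0,1,\dots$, with $x(0)=x_0$. It is robustly globally stabilizable by means of bounded sampled-data control with positive sampling rate if moreover $k$ can be taken bounded. *)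

theory Defs
  imports "HOL-Analysis.Analysis"
begin

text \<open>Maps on \<open>[0,\<infinity>)\<close> are represented by maps on the whole real line of which
  only the values at nonnegative arguments are ever constrained or used.\<close>

definition class_N :: "(real \<Rightarrow> real) \<Rightarrow> bool" where
  "class_N g \<longleftrightarrow> continuous_on {0..} g \<and> mono_on {0..} g \<and> g 0 = 0"

definition class_K :: "(real \<Rightarrow> real) \<Rightarrow> bool" where
  "class_K g \<longleftrightarrow> continuous_on {0..} g \<and> strict_mono_on {0..} g \<and> g 0 = 0"

definition class_K_inf :: "(real \<Rightarrow> real) \<Rightarrow> bool" where
  "class_K_inf g \<longleftrightarrow> class_K g \<and> \<not> bounded (g ` {0..})"

definition class_KL :: "(real \<Rightarrow> real \<Rightarrow> real) \<Rightarrow> bool" where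
  "class_KL \<sigma> \<longleftrightarrow>
     continuous_on ({0..} \<times> {0..}) (\<lambda>(s, t). \<sigma> s t) \<and>
     (\<forall>t\<ge>0. class_K (\<lambda>s. \<sigma> s t)) \<and>
     (\<forall>s\<ge>0. antimono_on {0..} (\<sigma> s) \<and> (\<sigma> s \<longlongrightarrow> 0) at_top)"

definition locally_bounded_on ::
    "'a::topological_space set \<Rightarrow> ('a \<Rightarrow> 'b::metric_space) \<Rightarrow> bool" where
  "locally_bounded_on S g \<longleftrightarrow> (\<forall>C. compact C \<and> C \<subseteq> S \<longrightarrow> bounded (g ` C))"

definition Linf_loc :: "'a::euclidean_space set \<Rightarrow> (real \<Rightarrow> 'a) set" where
  "Linf_loc D = {d. d \<in> borel_measurable (lebesgue_on {0..}) \<and> (\<forall>t\<ge>0. d t \<in> D) \<and>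
     (\<forall>T\<ge>0. \<exists>M. AE t in lebesgue_on {0..T}. norm (d t) \<le> M)}"

definition sampling_inputs :: "(real \<Rightarrow> real) set" where
  "sampling_inputs = {e. e \<in> borel_measurable (lebesgue_on {0..}) \<and> (\<forall>t\<ge>0. 0 \<le> e t) \<and>
     locally_bounded_on {0..} e}"

text \<open>Absolute continuity on a real interval: the members of a division are compact
  intervals \<open>K = [Inf K, Sup K]\<close> with pairwise disjoint interiors.\<close>

definition abs_continuous_on :: "real set \<Rightarrow> (real \<Rightarrow> 'b::real_normed_vector) \<Rightarrow> bool" where
  "abs_continuous_on S x \<longleftrightarrow>
     (\<forall>\<epsilon>>0. \<exists>\<delta>>0. \<forall>\<D> T. \<D> division_of T \<and> T \<subseteq> S \<and> (\<Sum>K\<in>\<D>. Sup K - Inf K) < \<delta>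
        \<longrightarrow> (\<Sum>K\<in>\<D>. norm (x (Sup K) - x (Inf K))) < \<epsilon>)"

definition H1 :: "('d::euclidean_space \<Rightarrow> 'x::euclidean_space \<Rightarrow> 'u::euclidean_space \<Rightarrow> 'x)
    \<Rightarrow> 'd set \<Rightarrow> 'u set \<Rightarrow> bool" where
  "H1 f D U \<longleftrightarrow>
     continuous_on (D \<times> UNIV \<times> U) (\<lambda>(d, x, u). f d x u) \<and>
     (\<forall>S. S \<subseteq> UNIV \<times> U \<and> bounded S \<longrightarrow>
        (\<exists>L\<ge>0. \<forall>d\<in>D. \<forall>x y u. (x, u) \<in> S \<and> (y, u) \<in> S \<longrightarrow>
           (x - y) \<bullet> (f d x u - f d y u) \<le> L * (norm (x - y))\<^sup>2))"

definition H2 :: "('d::euclidean_space \<Rightarrow> 'x::euclidean_space \<Rightarrow> 'u::euclidean_space \<Rightarrow> 'x)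
    \<Rightarrow> 'd set \<Rightarrow> 'u set \<Rightarrow> bool" where
  "H2 f D U \<longleftrightarrow>
     (\<exists>a. class_K_inf a \<and> (\<forall>u\<in>U. \<forall>d\<in>D. \<forall>x. norm (f d x u) \<le> a (norm x + norm u)))"

text \<open>Solution on \<open>[s,t]\<close> with the control held at \<open>v\<close>.\<close>

definition solves_const ::
    "('d \<Rightarrow> 'x::euclidean_space \<Rightarrow> 'u \<Rightarrow> 'x) \<Rightarrow> (real \<Rightarrow> 'd) \<Rightarrow> 'u \<Rightarrow> real \<Rightarrow> real
      \<Rightarrow> (real \<Rightarrow> 'x) \<Rightarrow> bool" where
  "solves_const f d v s t x \<longleftrightarrow>
     abs_continuous_on {s..t} x \<and>
     (AE q in lebesgue_on {s..t}. (x has_vector_derivative f (d q) (x q) v) (at q within {s..t}))"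

fun sample_time :: "real \<Rightarrow> (real \<Rightarrow> real) \<Rightarrow> nat \<Rightarrow> real" where
  "sample_time h e 0 = 0"
| "sample_time h e (Suc i) = sample_time h e i + h * exp (- e (sample_time h e i))"

text \<open>Imposing \<open>solves_const\<close> on the closed sampling intervals encodes that the value at the
  next sampling time is the left limit there. For \<open>h > 0\<close> and locally bounded \<open>e\<close> the sampling
  times tend to infinity, so that \<open>x\<close> is determined on all of \<open>[0,\<infinity>)\<close>.\<close>

definition sampled_solution ::
    "('d \<Rightarrow> 'x::euclidean_space \<Rightarrow> 'u \<Rightarrow> 'x) \<Rightarrow> (real \<Rightarrow> 'd) \<Rightarrow> ('x \<Rightarrow> 'u) \<Rightarrow> real
      \<Rightarrow> (real \<Rightarrow> real) \<Rightarrow> 'x \<Rightarrow> (real \<Rightarrow> 'x) \<Rightarrow> bool" where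
  "sampled_solution f d k h e x0 x \<longleftrightarrow>
     x 0 = x0 \<and>
     (\<forall>i. solves_const f d (k (x (sample_time h e i)))
            (sample_time h e i) (sample_time h e (Suc i)) x)"

text \<open>A property of ``the solution'' is rendered below as: a solution exists on the whole time
  interval in question, and every such solution has the property. Under \<open>H1\<close> solutions are
  unique.\<close>

definition robustly_reachable ::
    "('d::euclidean_space \<Rightarrow> 'x::euclidean_space \<Rightarrow> 'u::euclidean_space \<Rightarrow> 'x)
      \<Rightarrow> 'd set \<Rightarrow> 'u set \<Rightarrow> real \<Rightarrow> 'x set \<Rightarrow> 'x set \<Rightarrow> bool" where
  "robustly_reachable f D U r A \<Omega> \<longleftrightarrow>
     (\<exists>v\<in>U. \<exists>c\<ge>0. \<exists>a b. class_N a \<and> class_N b \<and>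
        (\<forall>x0\<in>\<Omega>. \<forall>d\<in>Linf_loc D. \<exists>T. 0 \<le> T \<and> T \<le> c + b (norm x0) \<and>
           (\<exists>x. x 0 = x0 \<and> solves_const f d v 0 (T + r) x) \<and>
           (\<forall>x. x 0 = x0 \<and> solves_const f d v 0 (T + r) x \<longrightarrow>
              (\<forall>t\<in>{0..T + r}. norm (x t) \<le> a (norm x0)) \<and>
              (\<forall>t\<in>{T..T + r}. x t \<in> A) \<and>
              (\<forall>t\<in>{0..T}. x t \<in> \<Omega>))))"

definition admissible_feedback ::
    "('d::euclidean_space \<Rightarrow> 'x::euclidean_space \<Rightarrow> 'u::euclidean_space \<Rightarrow> 'x)
      \<Rightarrow> 'd set \<Rightarrow> 'u set \<Rightarrow> ('x \<Rightarrow> 'u) \<Rightarrow> bool" where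
  "admissible_feedback f D U k \<longleftrightarrow>
     range k \<subseteq> U \<and> locally_bounded_on UNIV k \<and> k 0 = 0 \<and>
     (\<exists>\<kappa>. class_K_inf \<kappa> \<and>
        (\<forall>d\<in>D. \<forall>z x. norm (f d z (k x)) \<le> \<kappa> (norm z + norm x)))"

definition globally_stabilizing_feedback ::
    "('d::euclidean_space \<Rightarrow> 'x::euclidean_space \<Rightarrow> 'u::euclidean_space \<Rightarrow> 'x)
      \<Rightarrow> 'd set \<Rightarrow> 'u set \<Rightarrow> ('x \<Rightarrow> 'u) \<Rightarrow> bool" where
  "globally_stabilizing_feedback f D U k \<longleftrightarrow>
     admissible_feedback f D U k \<and>
     (\<exists>h>0. \<exists>\<sigma>. class_KL \<sigma> \<and>
        (\<forall>x0. \<forall>d\<in>Linf_loc D. \<forall>e\<in>sampling_inputs.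
           (\<exists>x. sampled_solution f d k h e x0 x) \<and>
           (\<forall>x. sampled_solution f d k h e x0 x \<longrightarrow> (\<forall>t\<ge>0. norm (x t) \<le> \<sigma> (norm x0) t))))"

definition bounded_robustly_globally_stabilizable ::
    "('d::euclidean_space \<Rightarrow> 'x::euclidean_space \<Rightarrow> 'u::euclidean_space \<Rightarrow> 'x)
      \<Rightarrow> 'd set \<Rightarrow> 'u set \<Rightarrow> bool" where
  "bounded_robustly_globally_stabilizable f D U \<longleftrightarrow>
     (\<exists>k. globally_stabilizing_feedback f D U k \<and> bounded (range k))"

end

theory Submission
  imports Defs
begin

text \<open>Let the level of a state outside \<open>\<Theta> = \<Omega>\<^sub>1\<close> be the least \<open>j\<close> with \<open>x \<in> \<Omega>\<^sub>j\<close>. The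
  stabilizing feedback is the local feedback on \<open>\<Theta>\<close> and, elsewhere, the constant control that
  steers the state into lower levels. The period is at most \<open>r\<close>, the time which that motion is
  guaranteed to spend in the lower levels, so a sampling instant falls into this window. Hence at
  most \<open>N - 1\<close> switches, each with bounded duration and amplitude, lead to a sampling instant in
  \<open>\<Theta>\<close>, from which on the motion is one of the local sampled-data system; a period \<open>h \<le> h\<^sub>0\<close> is
  admissible there because the factor \<open>h / h\<^sub>0 \<le> 1\<close> can be absorbed into the sampling input. A
  transient bound that vanishes at \<open>0\<close> and a delay depending on \<open>|x\<^sub>0|\<close> still leave a class \<open>KL\<close>
  estimate.\<close>

section \<open>Absolutely continuous functions\<close>

text \<open>Reachability speaks of solutions with one constant control, the closed loop of a motion
  restarted at every sampling time. The link between them is uniqueness. \<open>H1\<close> bounds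
  differences of \<open>f\<close> from one side only, which still gives uniqueness forward in time,
  but the squared distance of two solutions has a derivative merely almost everywhere. Hence the
  work on absolute continuity: gauge divisions show that an absolutely continuous function with
  nonpositive derivative off a negligible set does not increase from left to right. Existence is not
  derived from the differential equation; every sampling step of the closed loop is cut out of a
  solution supplied by P1 or P2. Restarting at a sampling time translates both the disturbance and
  the sampling input. Delays and transient bounds are therefore carried as functions of the norm of
  the current state alone, uniform in all inputs, so that they can be composed. A constant control
  need not vanish, whereas the growth bound must vanish at the origin. This is reconciled by using
  constant controls outside \<Theta> only, where the norm of the state is bounded below.\<close>

lemma abs_continuous_on_subset:
  "abs_continuous_on S x \<Longrightarrow> T \<subseteq> S \<Longrightarrow> abs_continuous_on T x"
  unfolding abs_continuous_on_def by (meson order_trans)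

lemma abs_continuous_on_imp_continuous_on:
  assumes "abs_continuous_on {a..b} x"
  shows "continuous_on {a..b} x"
  unfolding continuous_on_iff
proof (intro ballI allI impI)
  fix q and e :: real
  assume q: "q \<in> {a..b}" and "0 < e"
  then obtain \<delta> where "\<delta> > 0" and \<delta>:
    "\<And>\<D> T. \<D> division_of T \<Longrightarrow> T \<subseteq> {a..b} \<Longrightarrow> (\<Sum>K\<in>\<D>. Sup K - Inf K) < \<delta> \<Longrightarrow>
       (\<Sum>K\<in>\<D>. norm (x (Sup K) - x (Inf K))) < e"
    using assms unfolding abs_continuous_on_def by meson
  have *: "dist (x v) (x u) < e" if "u \<le> v" "v - u < \<delta>" "u \<in> {a..b}" "v \<in> {a..b}" for u v
  proof -
    have "{{u..v}} division_of {u..v}"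
      using that(1) division_of_self[of u v] by simp
    from \<delta>[OF this] that show ?thesis
      by (simp add: dist_norm)
  qed
  show "\<exists>d>0. \<forall>y\<in>{a..b}. dist y q < d \<longrightarrow> dist (x y) (x q) < e"
  proof (intro exI[of _ \<delta>] conjI ballI impI \<open>\<delta> > 0\<close>)
    fix y assume "y \<in> {a..b}" "dist y q < \<delta>"
    then show "dist (x y) (x q) < e"
      using *[of y q] *[of q y] q by (cases "y \<le> q") (auto simp: dist_commute dist_real_def)
  qed
qed

lemma abs_continuous_on_translation:
  assumes "abs_continuous_on {s + \<tau>..t + \<tau>} x"
  shows "abs_continuous_on {s..t} (\<lambda>q. x (\<tau> + q))"
  unfolding abs_continuous_on_def
proof (intro allI impI)
  fix e :: real assume "e > 0"
  then obtain \<delta> where "\<delta> > 0" and \<delta>: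
    "\<And>\<D> T. \<D> division_of T \<Longrightarrow> T \<subseteq> {s + \<tau>..t + \<tau>} \<Longrightarrow> (\<Sum>K\<in>\<D>. Sup K - Inf K) < \<delta> \<Longrightarrow>
       (\<Sum>K\<in>\<D>. norm (x (Sup K) - x (Inf K))) < e"
    using assms unfolding abs_continuous_on_def by meson
  have "(\<Sum>K\<in>\<D>. norm (x (\<tau> + Sup K) - x (\<tau> + Inf K))) < e"
    if \<D>: "\<D> division_of T" and T: "T \<subseteq> {s..t}" and len: "(\<Sum>K\<in>\<D>. Sup K - Inf K) < \<delta>" for \<D> T
  proof -
    have inj: "inj_on ((`) ((+) \<tau>)) \<D>"
      by (simp add: inj_on_def inj_image_eq_iff)
    have K: "Sup ((+) \<tau> ` K) = \<tau> + Sup K" "Inf ((+) \<tau> ` K) = \<tau> + Inf K" if K: "K \<in> \<D>" for K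
    proof -
      obtain u v where "K = cbox u v" "K \<noteq> {}"
        using division_ofD(3,4)[OF \<D>] K by metis
      then show "Sup ((+) \<tau> ` K) = \<tau> + Sup K" "Inf ((+) \<tau> ` K) = \<tau> + Inf K"
        by auto
    qed
    have "(`) ((+) \<tau>) ` \<D> division_of (+) \<tau> ` T"
    proof (rule division_ofI)
      show "finite ((`) ((+) \<tau>) ` \<D>)" "\<Union> ((`) ((+) \<tau>) ` \<D>) = (+) \<tau> ` T"
        using division_ofD(1,6)[OF \<D>] by (auto simp: image_Union)
      fix K' assume "K' \<in> (`) ((+) \<tau>) ` \<D>"
      then obtain K where K': "K \<in> \<D>" "K' = (+) \<tau> ` K"
        by blast
      then show "K' \<subseteq> (+) \<tau> ` T" "K' \<noteq> {}"
        using division_ofD(2,3)[OF \<D>] by auto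
      show "\<exists>a b. K' = cbox a b"
        using division_ofD(4)[OF \<D> K'(1)] K'(2) by (metis cbox_translation)
      fix L' assume L': "L' \<in> (`) ((+) \<tau>) ` \<D>" "K' \<noteq> L'"
      then obtain L where L: "L \<in> \<D>" "L' = (+) \<tau> ` L"
        by blast
      have "interior K \<inter> interior L = {}"
        using division_ofD(5)[OF \<D> K'(1) L(1)] K' L L' by auto
      then show "interior K' \<inter> interior L' = {}"
        by (auto simp: K' L interior_translation)
    qed
    moreover have "(+) \<tau> ` T \<subseteq> {s + \<tau>..t + \<tau>}"
      using T by auto
    ultimately show ?thesis
      using \<delta>[of "(`) ((+) \<tau>) ` \<D>" "(+) \<tau> ` T"] len by (simp add: sum.reindex[OF inj] K)
  qed
  then show "\<exists>\<delta>>0. \<forall>\<D> T. \<D> division_of T \<and> T \<subseteq> {s..t} \<and> (\<Sum>K\<in>\<D>. Sup K - Inf K) < \<delta> \<longrightarrow>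
      (\<Sum>K\<in>\<D>. norm (x (\<tau> + Sup K) - x (\<tau> + Inf K))) < e"
    using \<open>\<delta> > 0\<close> by blast
qed

lemma division_of_real_Inf_Sup:
  fixes T :: "real set"
  assumes "\<D> division_of T" "K \<in> \<D>"
  shows "K = {Inf K..Sup K}" "Inf K \<le> Sup K" "Inf K \<in> T" "Sup K \<in> T"
proof -
  obtain u v where "K = {u..v}" "K \<noteq> {}"
    using division_ofD(3,4)[OF assms] by (metis cbox_interval)
  then show "K = {Inf K..Sup K}" "Inf K \<le> Sup K"
    by auto
  then have "Inf K \<in> K" "Sup K \<in> K"
    by (metis atLeastAtMost_iff order_refl)+
  then show "Inf K \<in> T" "Sup K \<in> T"
    using division_ofD(2)[OF assms] by auto
qed

text \<open>Serves products such as a weighted squared distance, whose increments are controlled by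
  those of the factors. The term \<open>\<bar>v - u\<bar>\<close> admits a Lipschitz factor; summed
  over a division it gives the total length.\<close>

lemma abs_continuous_on_dominated:
  fixes z :: "real \<Rightarrow> 'c::real_normed_vector"
  assumes x: "abs_continuous_on S x" and y: "abs_continuous_on S y"
    and bd: "\<And>u v. u \<in> S \<Longrightarrow> v \<in> S \<Longrightarrow>
      norm (z v - z u) \<le> C * (norm (x v - x u) + norm (y v - y u) + \<bar>v - u\<bar>)"
    and "C > 0"
  shows "abs_continuous_on S z"
  unfolding abs_continuous_on_def
proof (intro allI impI)
  fix e :: real assume "e > 0"
  then have e: "e / (3 * C) > 0"
    using \<open>C > 0\<close> by simp
  obtain \<delta>1 where "\<delta>1 > 0" and \<delta>1:
    "\<And>\<D> T. \<D> division_of T \<Longrightarrow> T \<subseteq> S \<Longrightarrow> (\<Sum>K\<in>\<D>. Sup K - Inf K) < \<delta>1 \<Longrightarrow>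
       (\<Sum>K\<in>\<D>. norm (x (Sup K) - x (Inf K))) < e / (3 * C)"
    using x e unfolding abs_continuous_on_def by meson
  obtain \<delta>2 where "\<delta>2 > 0" and \<delta>2:
    "\<And>\<D> T. \<D> division_of T \<Longrightarrow> T \<subseteq> S \<Longrightarrow> (\<Sum>K\<in>\<D>. Sup K - Inf K) < \<delta>2 \<Longrightarrow>
       (\<Sum>K\<in>\<D>. norm (y (Sup K) - y (Inf K))) < e / (3 * C)"
    using y e unfolding abs_continuous_on_def by meson
  \<comment> \<open>The third entry bounds the total length itself, the third summand in the
    domination.\<close>
  define \<delta> where "\<delta> = min (min \<delta>1 \<delta>2) (e / (3 * C))"
  have "(\<Sum>K\<in>\<D>. norm (z (Sup K) - z (Inf K))) < e"
    if \<D>: "\<D> division_of T" and T: "T \<subseteq> S" and len: "(\<Sum>K\<in>\<D>. Sup K - Inf K) < \<delta>" for \<D> T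
  proof -
    have "(\<Sum>K\<in>\<D>. norm (z (Sup K) - z (Inf K))) \<le>
      (\<Sum>K\<in>\<D>. C * (norm (x (Sup K) - x (Inf K)) + norm (y (Sup K) - y (Inf K)) + (Sup K - Inf K)))"
    proof (rule sum_mono)
      fix K assume K: "K \<in> \<D>"
      note I = division_of_real_Inf_Sup[OF \<D> K]
      show "norm (z (Sup K) - z (Inf K)) \<le>
        C * (norm (x (Sup K) - x (Inf K)) + norm (y (Sup K) - y (Inf K)) + (Sup K - Inf K))"
        using bd[of "Inf K" "Sup K"] I T by auto
    qed
    also have "\<dots> = C * ((\<Sum>K\<in>\<D>. norm (x (Sup K) - x (Inf K))) +
        (\<Sum>K\<in>\<D>. norm (y (Sup K) - y (Inf K))) + (\<Sum>K\<in>\<D>. Sup K - Inf K))"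
      by (simp add: sum_distrib_left[symmetric] sum.distrib)
    also have "\<dots> < C * (e / (3 * C) + e / (3 * C) + e / (3 * C))"
      using \<delta>1[OF \<D> T] \<delta>2[OF \<D> T] len \<open>C > 0\<close>
      by (intro mult_strict_left_mono add_strict_mono) (auto simp: \<delta>_def)
    also have "\<dots> = e"
      using \<open>C > 0\<close> by (simp add: field_simps)
    finally show ?thesis .
  qed
  moreover have "\<delta> > 0"
    using \<open>\<delta>1 > 0\<close> \<open>\<delta>2 > 0\<close> e by (simp add: \<delta>_def)
  ultimately show "\<exists>\<delta>>0. \<forall>\<D> T. \<D> division_of T \<and> T \<subseteq> S \<and> (\<Sum>K\<in>\<D>. Sup K - Inf K) < \<delta> \<longrightarrow>
      (\<Sum>K\<in>\<D>. norm (z (Sup K) - z (Inf K))) < e"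
    by blast
qed

section \<open>Monotonicity from an almost everywhere nonpositive derivative\<close>

lemma has_real_derivative_nonpos_straddle:
  fixes g :: "real \<Rightarrow> real"
  assumes "(g has_real_derivative D) (at q within S)" "D \<le> 0" "0 < e"
  shows "\<exists>\<delta>>0. \<forall>u\<in>S. \<forall>v\<in>S. u \<le> q \<and> q \<le> v \<and> q - u < \<delta> \<and> v - q < \<delta> \<longrightarrow>
    g v - g u \<le> e * (v - u)"
proof -
  obtain \<delta> where "\<delta> > 0" and
    \<delta>: "\<And>y. y \<in> S \<Longrightarrow> \<bar>y - q\<bar> < \<delta> \<Longrightarrow> \<bar>g y - g q - D * (y - q)\<bar> \<le> e * \<bar>y - q\<bar>"
    using assms(1,3) unfolding has_field_derivative_def has_derivative_within_alt by fastforce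
  have "g v - g u \<le> e * (v - u)"
    if "u \<in> S" "v \<in> S" "u \<le> q" "q \<le> v" "q - u < \<delta>" "v - q < \<delta>" for u v
  proof -
    \<comment> \<open>The linear approximations on the two sides of the tag \<open>q\<close> add up
      to one on the whole interval, where the common slope \<open>D\<close> has a sign.\<close>
    have "g v - g q - D * (v - q) \<le> e * (v - q)" "g q - g u + D * (u - q) \<le> e * (q - u)"
      using \<delta>[of v] \<delta>[of u] that by (auto simp: abs_le_iff)
    moreover have "D * (v - u) \<le> 0"
      using \<open>D \<le> 0\<close> that by (simp add: mult_nonpos_nonneg)
    ultimately show ?thesis
      by (simp add: algebra_simps)
  qed
  then show ?thesis
    using \<open>\<delta> > 0\<close> by blast
qed

text \<open>Outer regularity controls \<open>V - N\<close>; since \<open>N\<close> is null, this is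
  already the measure of \<open>V\<close>.\<close>

lemma negligible_outer_open:
  fixes N :: "'a::euclidean_space set"
  assumes "negligible N" "e > 0"
  obtains V where "open V" "N \<subseteq> V" "V \<in> lmeasurable" "measure lebesgue V < e"
proof -
  obtain V where V: "open V" "N \<subseteq> V" "V - N \<in> lmeasurable" "emeasure lebesgue (V - N) < ennreal e"
    using sets_lebesgue_outer_open[of N e] assms negligible_imp_sets by blast
  have "V \<in> lmeasurable"
    using V assms(1) fmeasurable.Un[of "V - N" lebesgue N]
    by (simp add: negligible_imp_measurable Un_absorb2)
  moreover have "measure lebesgue V = measure lebesgue (V - N)"
    using assms(1) \<open>V \<in> lmeasurable\<close>
    by (simp add: measure_Diff_null_set fmeasurableD negligible_iff_null_sets)
  moreover have "measure lebesgue (V - N) < e"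
    using V(3,4) assms(2) by (simp add: emeasure_eq_measure2 ennreal_less_iff)
  ultimately show thesis
    using that V by metis
qed

text \<open>A fine tagged division splits into tags outside \<open>N\<close>, where \<open>g\<close> increases by at most
  \<open>e\<close> times the length, and tags in \<open>N\<close>, whose intervals lie in an open set of small measure.\<close>

lemma abs_continuous_on_nonpos_derivative:
  fixes g :: "real \<Rightarrow> real"
  assumes "a \<le> b" and ac: "abs_continuous_on {a..b} g" and N: "negligible N"
    and der: "\<And>q. q \<in> {a..b} - N \<Longrightarrow> \<exists>D\<le>0. (g has_real_derivative D) (at q within {a..b})"
  shows "g b \<le> g a"
proof -
  have "g b - g a \<le> e" if "e > 0" for e
  proof -
    \<comment> \<open>Tags outside \<open>N\<close> will contribute at most
      \<open>e' * (b - a)\<close> and tags in \<open>N\<close> at most \<open>e'\<close>. The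
      summand 1 also covers \<open>a = b\<close>.\<close>
    define e' where "e' = e / (b - a + 1)"
    have e': "e' > 0" "e' * (b - a) + e' = e"
      using \<open>a \<le> b\<close> \<open>e > 0\<close> by (auto simp: e'_def divide_simps) (simp add: algebra_simps)
    obtain \<eta> where "\<eta> > 0" and \<eta>:
      "\<And>\<D> T. \<D> division_of T \<Longrightarrow> T \<subseteq> {a..b} \<Longrightarrow> (\<Sum>K\<in>\<D>. Sup K - Inf K) < \<eta> \<Longrightarrow>
         (\<Sum>K\<in>\<D>. norm (g (Sup K) - g (Inf K))) < e'"
      using ac e'(1) unfolding abs_continuous_on_def by meson
    obtain V where V: "open V" "N \<subseteq> V" "V \<in> lmeasurable" "measure lebesgue V < \<eta>"
      using negligible_outer_open[OF N \<open>\<eta> > 0\<close>] .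
    have "\<exists>\<delta>>0. q \<in> {a..b} - N \<longrightarrow> (\<forall>u\<in>{a..b}. \<forall>v\<in>{a..b}.
        u \<le> q \<and> q \<le> v \<and> q - u < \<delta> \<and> v - q < \<delta> \<longrightarrow> g v - g u \<le> e' * (v - u))" for q
    proof (cases "q \<in> {a..b} - N")
      case True
      then obtain D where "D \<le> 0" "(g has_real_derivative D) (at q within {a..b})"
        using der by blast
      from has_real_derivative_nonpos_straddle[OF this(2,1) e'(1)] show ?thesis
        by blast
    qed (use zero_less_one in blast)
    then obtain \<delta> where \<delta>: "\<And>q. \<delta> q > 0" "\<And>q u v. q \<in> {a..b} - N \<Longrightarrow> u \<in> {a..b} \<Longrightarrow> v \<in> {a..b} \<Longrightarrow>
        u \<le> q \<Longrightarrow> q \<le> v \<Longrightarrow> q - u < \<delta> q \<Longrightarrow> v - q < \<delta> q \<Longrightarrow> g v - g u \<le> e' * (v - u)"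
      by metis
    define \<gamma> where "\<gamma> q = (if q \<in> N then V else ball q (\<delta> q))" for q
    have "gauge \<gamma>"
      using V \<delta>(1) by (auto simp: gauge_def \<gamma>_def)
    then obtain p where p: "p tagged_division_of {a..b}" "\<gamma> fine p"
      using fine_division_exists_real by blast
    note pD = tagged_division_ofD[OF p(1)]
    define pN where "pN = {(q, K) \<in> p. q \<in> N}"
    have fin: "finite p" "finite pN"
      using pD(1) by (auto simp: pN_def intro: finite_subset[of _ p])
    have K: "\<exists>u v. K = {u..v} \<and> u \<le> q \<and> q \<le> v \<and> u \<in> {a..b} \<and> v \<in> {a..b}" if qK: "(q, K) \<in> p" for q K
    proof -
      obtain u v where "K = {u..v}"
        using pD(4)[OF qK] by (metis cbox_interval)
      then show ?thesis
        using pD(2,3)[OF qK] by (intro exI[of _ u] exI[of _ v]) (auto simp: subset_iff)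
    qed
    have "g b - g a = (\<Sum>(q, K)\<in>p. g (Sup K) - g (Inf K))"
      by (rule additive_tagged_division_1[OF \<open>a \<le> b\<close> p(1), symmetric])
    also have "\<dots> = (\<Sum>(q, K)\<in>p - pN. g (Sup K) - g (Inf K)) + (\<Sum>(q, K)\<in>pN. g (Sup K) - g (Inf K))"
      by (rule sum.subset_diff) (auto simp: pN_def fin)
    finally have split: "g b - g a = \<dots>" .
    have "(\<Sum>(q, K)\<in>p - pN. g (Sup K) - g (Inf K)) \<le> (\<Sum>(q, K)\<in>p - pN. e' * (Sup K - Inf K))"
    proof (rule sum_mono, clarify)
      fix q K assume qK: "(q, K) \<in> p" "(q, K) \<notin> pN"
      obtain u v where uv: "K = {u..v}" "u \<le> q" "q \<le> v" "u \<in> {a..b}" "v \<in> {a..b}"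
        using K[OF qK(1)] by blast
      have q: "q \<in> {a..b} - N"
        using qK uv by (auto simp: pN_def)
      then have "K \<subseteq> ball q (\<delta> q)"
        using fineD[OF p(2) qK(1)] by (simp add: \<gamma>_def)
      moreover have "u \<in> K" "v \<in> K"
        using uv by auto
      ultimately have "u \<in> ball q (\<delta> q)" "v \<in> ball q (\<delta> q)"
        by auto
      then show "g (Sup K) - g (Inf K) \<le> e' * (Sup K - Inf K)"
        using \<delta>(2)[OF q, of u v] uv by (auto simp: dist_real_def)
    qed
    \<comment> \<open>Lengths are nonnegative, so the tags in \<open>N\<close> may be added back;
      the sum over all of \<open>p\<close> telescopes.\<close>
    also have "(\<Sum>(q, K)\<in>p - pN. e' * (Sup K - Inf K)) \<le> (\<Sum>(q, K)\<in>p. e' * (Sup K - Inf K))"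
    proof (rule sum_mono2)
      fix qK assume "qK \<in> p - (p - pN)"
      then obtain q K where qK: "qK = (q, K)" "(q, K) \<in> p"
        by (cases qK) auto
      obtain u v where "K = {u..v}" "u \<le> v"
        using K[OF qK(2)] by force
      then show "0 \<le> (case qK of (q, K) \<Rightarrow> e' * (Sup K - Inf K))"
        using e'(1) qK(1) by simp
    qed (use fin in auto)
    also have "\<dots> = e' * (b - a)"
      using additive_tagged_division_1[OF \<open>a \<le> b\<close> p(1), of "\<lambda>x. x"]
      by (simp add: case_prod_unfold sum_distrib_left[symmetric])
    finally have good: "(\<Sum>(q, K)\<in>p - pN. g (Sup K) - g (Inf K)) \<le> e' * (b - a)" .
    have "(\<Sum>(q, K)\<in>pN. g (Sup K) - g (Inf K)) \<le> e'"
    proof -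
      have "pN tagged_partial_division_of {a..b}"
        by (rule tagged_partial_division_subset[of p]) (use p(1) in \<open>auto simp: pN_def tagged_division_of_def\<close>)
      then have td: "pN tagged_division_of \<Union>(snd ` pN)"
        by (rule tagged_partial_division_of_Union_self)
      then have div: "snd ` pN division_of \<Union>(snd ` pN)"
        by (rule division_of_tagged_division)
      have snd_pN: "\<exists>q. (q, K) \<in> pN" if "K \<in> snd ` pN" for K
        using that by force
      have "K \<subseteq> {a..b}" if "(q, K) \<in> pN" for q K
        using pD(3)[of q K] that by (simp add: pN_def)
      then have sub: "\<Union>(snd ` pN) \<subseteq> {a..b}"
        using snd_pN by (meson Union_least)
      have "K \<subseteq> V" if "(q, K) \<in> pN" for q K
        using fineD[OF p(2), of q K] that by (simp add: pN_def \<gamma>_def)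
      then have subV: "\<Union>(snd ` pN) \<subseteq> V"
        using snd_pN by (meson Union_least)
      have "(\<Sum>K\<in>snd ` pN. Sup K - Inf K) = (\<Sum>K\<in>snd ` pN. measure lebesgue K)"
      proof (rule sum.cong)
        fix K assume "K \<in> snd ` pN"
        note division_of_real_Inf_Sup(1,2)[OF div this]
        moreover have "measure lebesgue {Inf K..Sup K} = Sup K - Inf K" if "Inf K \<le> Sup K"
          using that by simp
        ultimately show "Sup K - Inf K = measure lebesgue K"
          by metis
      qed simp
      also have "\<dots> = measure lebesgue (\<Union>(snd ` pN))"
        using content_division[OF div] .
      also have "\<dots> \<le> measure lebesgue V"
        using subV V(3) lmeasurable_division[OF div]
        by (intro measure_mono_fmeasurable) auto
      finally have "(\<Sum>K\<in>snd ` pN. Sup K - Inf K) < \<eta>"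
        using V(4) by simp
      then have *: "(\<Sum>K\<in>snd ` pN. norm (g (Sup K) - g (Inf K))) < e'"
        by (rule \<eta>[OF div sub])
      \<comment> \<open>Passing from tagged pairs to intervals requires a function that vanishes on
        every box with empty interior. The empty box is one of them, and \<open>Sup\<close> and
        \<open>Inf\<close> say nothing useful there, so its value is set to 0.\<close>
      define \<Delta> where "\<Delta> K = (if K = {} then 0 else g (Sup K) - g (Inf K))" for K
      have ne: "K \<noteq> {}" if "(q, K) \<in> pN" for q K
        using that pD(2) by (auto simp: pN_def)
      have "(\<Sum>(q, K)\<in>pN. g (Sup K) - g (Inf K)) = (\<Sum>(q, K)\<in>pN. \<Delta> K)"
        using ne by (intro sum.cong) (auto simp: \<Delta>_def)
      also have "\<dots> = (\<Sum>K\<in>snd ` pN. \<Delta> K)"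
      proof (rule sum.over_tagged_division_lemma[OF td])
        fix u v :: real assume "box u v = {}"
        then have "v \<le> u"
          by simp
        then show "\<Delta> (cbox u v) = 0"
          by (cases "u = v") (auto simp: \<Delta>_def)
      qed
      also have "\<dots> = (\<Sum>K\<in>snd ` pN. g (Sup K) - g (Inf K))"
        using ne by (intro sum.cong) (auto simp: \<Delta>_def)
      also have "\<dots> \<le> (\<Sum>K\<in>snd ` pN. norm (g (Sup K) - g (Inf K)))"
        by (rule sum_mono) simp
      finally show ?thesis
        using * by simp
    qed
    then show ?thesis
      using split good e'(2) by linarith
  qed
  then show ?thesis
    by (metis field_le_epsilon diff_le_eq add.commute)
qed

lemma abs_continuous_on_cong:
  assumes "abs_continuous_on S x" "\<And>q. q \<in> S \<Longrightarrow> x q = y q"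
  shows "abs_continuous_on S y"
proof -
  have "(\<Sum>K\<in>\<D>. norm (y (Sup K) - y (Inf K))) = (\<Sum>K\<in>\<D>. norm (x (Sup K) - x (Inf K)))"
    if "\<D> division_of T" "T \<subseteq> S" for \<D> T
    using division_of_real_Inf_Sup(3,4)[OF that(1)] that(2) assms(2) by (intro sum.cong) (auto simp: subset_iff)
  then show ?thesis
    using assms(1) unfolding abs_continuous_on_def by (smt (verit))
qed

section \<open>Solutions with constant control\<close>

text \<open>An explicit exceptional set can be united with a second one when two solutions are
  compared, and can be moved along with a time shift.\<close>

lemma solves_const_iff:
  fixes x :: "real \<Rightarrow> 'x::euclidean_space"
  shows "solves_const f d v s t x \<longleftrightarrow>
    abs_continuous_on {s..t} x \<and>
    (\<exists>N. negligible N \<and>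
      (\<forall>q\<in>{s..t} - N. (x has_vector_derivative f (d q) (x q) v) (at q within {s..t})))"
proof -
  have "(AE q in lebesgue_on {s..t}. P q) \<longleftrightarrow> (\<exists>N. negligible N \<and> (\<forall>q\<in>{s..t} - N. P q))"
    for P :: "real \<Rightarrow> bool"
    by (subst AE_restrict_space_iff) (auto simp: eventually_ae_filter_negligible subset_iff Ball_def)
  then show ?thesis
    unfolding solves_const_def by presburger
qed

text \<open>The derivative is taken within the closed interval, so values elsewhere do not matter.
  This is what allows pieces of solutions to be glued.\<close>

lemma solves_const_cong:
  fixes x :: "real \<Rightarrow> 'x::euclidean_space"
  assumes "solves_const f d v s t x" "\<And>q. q \<in> {s..t} \<Longrightarrow> x q = y q"
  shows "solves_const f d v s t y"
proof -
  obtain N where N: "abs_continuous_on {s..t} x" "negligible N"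
    "\<And>q. q \<in> {s..t} - N \<Longrightarrow> (x has_vector_derivative f (d q) (x q) v) (at q within {s..t})"
    using assms(1) by (auto simp: solves_const_iff)
  have "(y has_vector_derivative f (d q) (y q) v) (at q within {s..t})" if "q \<in> {s..t} - N" for q
    using has_vector_derivative_transform[of q "{s..t}" y x] N(3)[OF that] that assms(2) by auto
  then show ?thesis
    using abs_continuous_on_cong[OF N(1) assms(2)] N(2) unfolding solves_const_iff by blast
qed

lemma solves_const_subinterval:
  fixes x :: "real \<Rightarrow> 'x::euclidean_space"
  assumes "solves_const f d v s t x" "s \<le> s'" "t' \<le> t"
  shows "solves_const f d v s' t' x"
proof -
  have sub: "{s'..t'} \<subseteq> {s..t}"
    using assms by auto
  then show ?thesis
    using assms(1) abs_continuous_on_subset[OF _ sub] has_vector_derivative_within_subset[OF _ sub]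
    unfolding solves_const_iff by (meson DiffD1 DiffD2 DiffI subsetD)
qed

lemma solves_const_translation:
  fixes x :: "real \<Rightarrow> 'x::euclidean_space"
  assumes "solves_const f d v (s + \<tau>) (t + \<tau>) x"
  shows "solves_const f (\<lambda>q. d (\<tau> + q)) v s t (\<lambda>q. x (\<tau> + q))"
proof -
  obtain N where N: "abs_continuous_on {s + \<tau>..t + \<tau>} x" "negligible N"
    "\<And>q. q \<in> {s + \<tau>..t + \<tau>} - N \<Longrightarrow>
      (x has_vector_derivative f (d q) (x q) v) (at q within {s + \<tau>..t + \<tau>})"
    using assms(1) by (auto simp: solves_const_iff)
  have img: "(+) \<tau> ` {s..t} = {s + \<tau>..t + \<tau>}"
    by (simp add: add.commute)
  have "((\<lambda>q. x (\<tau> + q)) has_vector_derivative f (d (\<tau> + q)) (x (\<tau> + q)) v) (at q within {s..t})"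
    if "q \<in> {s..t} - (+) (- \<tau>) ` N" for q
  proof -
    have "\<tau> + q \<in> {s + \<tau>..t + \<tau>} - N"
      using that by force
    from N(3)[OF this] have
      "(x has_vector_derivative f (d (\<tau> + q)) (x (\<tau> + q)) v) (at (\<tau> + q) within (+) \<tau> ` {s..t})"
      unfolding img .
    moreover have "((+) \<tau> has_vector_derivative 1) (at q within {s..t})"
      by (auto intro!: derivative_eq_intros simp: has_real_derivative_iff_has_vector_derivative[symmetric])
    ultimately show ?thesis
      using vector_diff_chain_within[of "(+) \<tau>" 1 q "{s..t}" x] by (simp add: o_def)
  qed
  then show ?thesis
    unfolding solves_const_iff
    using abs_continuous_on_translation[OF N(1)] negligible_translation[OF N(2)] by blast
qed

text \<open>The converse is the same translation by \<open>- \<tau>\<close>. The equivalence moves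
  between the absolute time of the closed loop and the time since a restart, in which P1 and P2 are
  stated.\<close>

lemma solves_const_translation_iff:
  fixes x :: "real \<Rightarrow> 'x::euclidean_space"
  shows "solves_const f (\<lambda>q. d (\<tau> + q)) v s t (\<lambda>q. x (\<tau> + q)) \<longleftrightarrow>
    solves_const f d v (\<tau> + s) (\<tau> + t) x"
proof
  assume "solves_const f (\<lambda>q. d (\<tau> + q)) v s t (\<lambda>q. x (\<tau> + q))"
  then show "solves_const f d v (\<tau> + s) (\<tau> + t) x"
    using solves_const_translation[of f "\<lambda>q. d (\<tau> + q)" v "\<tau> + s" "- \<tau>" "\<tau> + t" "\<lambda>q. x (\<tau> + q)"]
    by simp
next
  assume "solves_const f d v (\<tau> + s) (\<tau> + t) x"
  then show "solves_const f (\<lambda>q. d (\<tau> + q)) v s t (\<lambda>q. x (\<tau> + q))"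
    by (intro solves_const_translation) (simp add: add.commute)
qed

section \<open>Time shifts of disturbances and sampling inputs\<close>

lemma measurable_translation_nonneg:
  assumes "0 \<le> \<tau>"
  shows "(\<lambda>t::real. \<tau> + t) \<in> lebesgue_on {0..} \<rightarrow>\<^sub>M lebesgue_on {0..}"
proof (rule measurable_restrict_space2)
  have "(\<lambda>t::real. \<tau> + t) \<in> lebesgue \<rightarrow>\<^sub>M lebesgue"
    using lebesgue_affine_measurable[of "\<lambda>_. 1" \<tau>] by simp
  then show "(\<lambda>t. \<tau> + t) \<in> lebesgue_on {0..} \<rightarrow>\<^sub>M lebesgue"
    by (rule measurable_restrict_space1)
qed (use assms in auto)

lemma Linf_loc_shift:
  assumes "d \<in> Linf_loc D" "0 \<le> \<tau>"
  shows "(\<lambda>t. d (\<tau> + t)) \<in> Linf_loc D"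
proof -
  have "\<exists>M. AE t in lebesgue_on {0..T}. norm (d (\<tau> + t)) \<le> M" if T: "T \<ge> 0" for T
  proof -
    have "\<forall>T\<ge>0. \<exists>M. AE t in lebesgue_on {0..T}. norm (d t) \<le> M"
      using assms(1) by (simp add: Linf_loc_def)
    then obtain M where "AE t in lebesgue_on {0..\<tau> + T}. norm (d t) \<le> M"
      using assms(2) T add_nonneg_nonneg by blast
    then obtain N where N: "negligible N" "\<And>t. t \<in> {0..\<tau> + T} - N \<Longrightarrow> norm (d t) \<le> M"
      by (subst (asm) AE_restrict_space_iff) (auto simp: eventually_ae_filter_negligible subset_iff)
    have "norm (d (\<tau> + t)) \<le> M" if "t \<in> {0..T}" "t \<notin> (+) (- \<tau>) ` N" for t
      using N(2)[of "\<tau> + t"] that assms(2) by force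
    then have "{t. \<not> (t \<in> {0..T} \<longrightarrow> norm (d (\<tau> + t)) \<le> M)} \<subseteq> (+) (- \<tau>) ` N"
      by blast
    with negligible_translation[OF N(1), of "- \<tau>"]
    have "AE t in lebesgue. t \<in> {0..T} \<longrightarrow> norm (d (\<tau> + t)) \<le> M"
      unfolding eventually_ae_filter_negligible by blast
    then have "AE t in lebesgue_on {0..T}. norm (d (\<tau> + t)) \<le> M"
      by (subst AE_restrict_space_iff) simp_all
    then show ?thesis ..
  qed
  then show ?thesis
    using assms measurable_compose[OF measurable_translation_nonneg[OF assms(2)], of d borel] by (simp add: Linf_loc_def)
qed

text \<open>The constant \<open>c\<close> will be the logarithm of a ratio of periods, which
  rescales the sampling steps.\<close>

lemma sampling_inputs_shift_add:
  assumes "e \<in> sampling_inputs" "0 \<le> \<tau>" "0 \<le> c"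
  shows "(\<lambda>t. e (\<tau> + t) + c) \<in> sampling_inputs"
proof -
  have e: "e \<in> borel_measurable (lebesgue_on {0..})" "\<And>t. 0 \<le> t \<Longrightarrow> 0 \<le> e t"
    "\<And>C. compact C \<Longrightarrow> C \<subseteq> {0..} \<Longrightarrow> bounded (e ` C)"
    using assms(1) by (auto simp: sampling_inputs_def locally_bounded_on_def)
  have "bounded ((\<lambda>t. e (\<tau> + t) + c) ` C)" if "compact C" "C \<subseteq> {0..}" for C
  proof -
    have "bounded (e ` (+) \<tau> ` C)"
      using that assms(2) by (intro e(3) compact_translation) auto
    from bounded_translation[OF this, of c] show ?thesis
      by (simp add: image_image add.commute)
  qed
  then show ?thesis
    using measurable_compose[OF measurable_translation_nonneg[OF assms(2)] e(1)] e(2) assms(2,3)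
    by (auto simp: sampling_inputs_def locally_bounded_on_def)
qed

section \<open>Forward uniqueness of solutions\<close>

lemma exp_minus_Lipschitz:
  fixes a b :: real
  assumes "0 \<le> a" "0 \<le> b"
  shows "\<bar>exp (- a) - exp (- b)\<bar> \<le> \<bar>a - b\<bar>"
proof -
  have "\<bar>exp (- a) - exp (- b)\<bar> \<le> \<bar>a - b\<bar>" if "0 \<le> a" "a \<le> b" for a b :: real
  proof -
    have "exp (- a) - exp (- b) = exp (- a) * (1 - exp (a - b))"
      by (simp add: algebra_simps exp_add[symmetric])
    also have "\<dots> \<le> 1 * (b - a)"
    proof (rule mult_mono)
      show "1 - exp (a - b) \<le> b - a"
        using exp_ge_add_one_self[of "a - b"] by linarith
    qed (use that in auto)
    finally have "exp (- a) - exp (- b) \<le> b - a"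
      by simp
    moreover have "exp (- b) \<le> exp (- a)"
      using that by simp
    ultimately show ?thesis
      using that by linarith
  qed
  from this[of a b] this[of b a] assms show ?thesis
    by linarith
qed

text \<open>The one-sided Lipschitz bound makes \<open>exp (-2L(p-s)) \<bar>x p - y p\<bar>\<^sup>2\<close> nonincreasing.\<close>

lemma solves_const_unique:
  fixes x y :: "real \<Rightarrow> 'x::euclidean_space"
  assumes H1: "H1 f D U" and "v \<in> U" and d: "\<And>q. q \<in> {s..t} \<Longrightarrow> d q \<in> D"
    and x: "solves_const f d v s t x" and y: "solves_const f d v s t y" and "x s = y s"
    and q: "q \<in> {s..t}"
  shows "x q = y q"
proof -
  have sub: "{s..q} \<subseteq> {s..t}" and "s \<le> q"
    using q by auto
  obtain N1 N2 where N: "negligible N1" "negligible N2"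
    and dx: "\<And>p. p \<in> {s..q} - N1 \<Longrightarrow> (x has_vector_derivative f (d p) (x p) v) (at p within {s..q})"
    and dy: "\<And>p. p \<in> {s..q} - N2 \<Longrightarrow> (y has_vector_derivative f (d p) (y p) v) (at p within {s..q})"
    and ac: "abs_continuous_on {s..q} x" "abs_continuous_on {s..q} y"
    using solves_const_subinterval[OF x order_refl, of q] solves_const_subinterval[OF y order_refl, of q] q
    unfolding solves_const_iff by (metis atLeastAtMost_iff)
  \<comment> \<open>\<open>H1\<close> supplies a constant on bounded sets only, so both solutions
    are first confined to a common ball.\<close>
  have "bounded (x ` {s..q})" "bounded (y ` {s..q})"
    using ac by (auto intro!: compact_imp_bounded compact_continuous_image
        abs_continuous_on_imp_continuous_on)
  then obtain Rx Ry where "\<And>p. p \<in> {s..q} \<Longrightarrow> norm (x p) \<le> Rx" "\<And>p. p \<in> {s..q} \<Longrightarrow> norm (y p) \<le> Ry"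
    unfolding bounded_iff by blast
  define R where "R = max 1 (max Rx Ry)"
  have "R > 0"
    by (simp add: R_def)
  have R: "norm (x p) \<le> R" "norm (y p) \<le> R" if "p \<in> {s..q}" for p
    using \<open>\<And>p. p \<in> {s..q} \<Longrightarrow> norm (x p) \<le> Rx\<close>[OF that]
      \<open>\<And>p. p \<in> {s..q} \<Longrightarrow> norm (y p) \<le> Ry\<close>[OF that] by (auto simp: R_def)
  have "cball 0 R \<times> {v} \<subseteq> UNIV \<times> U" "bounded (cball (0::'x) R \<times> {v})"
    using \<open>v \<in> U\<close> by (auto intro: bounded_Times)
  then obtain L where "L \<ge> 0" and L: "\<And>d x y. d \<in> D \<Longrightarrow> norm x \<le> R \<Longrightarrow> norm y \<le> R \<Longrightarrow>
      (x - y) \<bullet> (f d x v - f d y v) \<le> L * (norm (x - y))\<^sup>2"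
    using H1 unfolding H1_def by (fastforce dest: spec[where x = "cball (0::'x) R \<times> {v}"])
  define z where "z p = x p - y p" for p
  define w where "w p = exp (- (2 * L * (p - s))) * (z p \<bullet> z p)" for p
  have z: "norm (z p) \<le> 2 * R" if "p \<in> {s..q}" for p
    using norm_triangle_ineq4[of "x p" "y p"] R[OF that] by (simp add: z_def)
  have "abs_continuous_on {s..q} w"
  proof (rule abs_continuous_on_dominated[OF ac])
    \<comment> \<open>Since \<open>norm (z p)\<close> is at most \<open>2 * R\<close>, increments of
      the squared distance are at most \<open>4 * R\<close> times those of \<open>x\<close> and
      \<open>y\<close>. The weight is at most 1 and has Lipschitz constant \<open>2 * L\<close>; its
      increments are multiplied by a squared distance of at most
      \<open>(2 * R)\<^sup>2\<close>.\<close>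
    show "0 < 4 * R + (2 * R)\<^sup>2 * (2 * L)"
      using \<open>R > 0\<close> \<open>L \<ge> 0\<close> by (simp add: add_pos_nonneg)
    fix u p assume u: "u \<in> {s..q}" and p: "p \<in> {s..q}"
    let ?E = "\<lambda>p. exp (- (2 * L * (p - s)))"
    have "z p \<bullet> z p - z u \<bullet> z u = (z p - z u) \<bullet> z p + (z p - z u) \<bullet> z u"
      by (simp add: inner_diff_left inner_commute[of "z u" "z p"])
    also have "norm \<dots> \<le> norm (z p - z u) * (2 * R) + norm (z p - z u) * (2 * R)"
      using z[OF u] z[OF p]
      by (intro norm_triangle_le add_mono order_trans[OF Cauchy_Schwarz_ineq2[folded real_norm_def]]
          mult_left_mono) auto
    also have "\<dots> \<le> 4 * R * (norm (x p - x u) + norm (y p - y u))"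
    proof -
      have "z p - z u = (x p - x u) - (y p - y u)"
        by (simp add: z_def)
      then have "norm (z p - z u) \<le> norm (x p - x u) + norm (y p - y u)"
        by (metis norm_triangle_ineq4)
      then show ?thesis
        using \<open>R > 0\<close> by simp
    qed
    finally have 1: "norm (z p \<bullet> z p - z u \<bullet> z u) \<le> 4 * R * (norm (x p - x u) + norm (y p - y u))" .
    have "\<bar>?E p - ?E u\<bar> \<le> \<bar>2 * L * (p - s) - 2 * L * (u - s)\<bar>"
      using u p \<open>L \<ge> 0\<close> by (intro exp_minus_Lipschitz) auto
    also have "\<dots> = 2 * L * \<bar>p - u\<bar>"
    proof -
      have "2 * L * (p - s) - 2 * L * (u - s) = 2 * L * (p - u)"
        by (simp add: algebra_simps)
      then show ?thesis
        using \<open>L \<ge> 0\<close> by (simp add: abs_mult)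
    qed
    finally have 2: "\<bar>?E p - ?E u\<bar> \<le> 2 * L * \<bar>p - u\<bar>" .
    have 3: "\<bar>z u \<bullet> z u\<bar> \<le> (2 * R)\<^sup>2"
      using power_mono[OF z[OF u] norm_ge_zero, of 2] by (simp add: power2_norm_eq_inner)
    have "w p - w u = ?E p * (z p \<bullet> z p - z u \<bullet> z u) + (z u \<bullet> z u) * (?E p - ?E u)"
      by (simp add: w_def algebra_simps)
    also have "norm \<dots> \<le> \<bar>?E p\<bar> * \<bar>z p \<bullet> z p - z u \<bullet> z u\<bar> + \<bar>z u \<bullet> z u\<bar> * \<bar>?E p - ?E u\<bar>"
      unfolding real_norm_def abs_mult[symmetric] by (rule abs_triangle_ineq)
    also have "\<dots> \<le> 1 * (4 * R * (norm (x p - x u) + norm (y p - y u))) +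
        (2 * R)\<^sup>2 * (2 * L * \<bar>p - u\<bar>)"
    proof (rule add_mono)
      have "\<bar>?E p\<bar> \<le> 1"
        using p \<open>L \<ge> 0\<close> by simp
      then show "\<bar>?E p\<bar> * \<bar>z p \<bullet> z p - z u \<bullet> z u\<bar> \<le>
          1 * (4 * R * (norm (x p - x u) + norm (y p - y u)))"
        using 1 by (intro mult_mono) auto
      show "\<bar>z u \<bullet> z u\<bar> * \<bar>?E p - ?E u\<bar> \<le> (2 * R)\<^sup>2 * (2 * L * \<bar>p - u\<bar>)"
        by (rule mult_mono[OF 3 2]) simp_all
    qed
    also have "\<dots> \<le> (4 * R + (2 * R)\<^sup>2 * (2 * L)) * (norm (x p - x u) + norm (y p - y u) + \<bar>p - u\<bar>)"
    proof -
      have "0 \<le> 4 * R * \<bar>p - u\<bar>"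
        "0 \<le> (2 * R)\<^sup>2 * (2 * L) * (norm (x p - x u) + norm (y p - y u))"
        using \<open>R > 0\<close> \<open>L \<ge> 0\<close> by (intro mult_nonneg_nonneg; simp)+
      then show ?thesis
        by (simp add: algebra_simps)
    qed
    finally show "norm (w p - w u) \<le>
        (4 * R + (2 * R)\<^sup>2 * (2 * L)) * (norm (x p - x u) + norm (y p - y u) + \<bar>p - u\<bar>)" .
  qed
  moreover have "negligible (N1 \<union> N2)"
    using N by simp
  moreover have "\<exists>D'\<le>0. (w has_real_derivative D') (at p within {s..q})"
    if p: "p \<in> {s..q} - (N1 \<union> N2)" for p
  proof -
    define z' where "z' = f (d p) (x p) v - f (d p) (y p) v"
    have "(z has_vector_derivative z') (at p within {s..q})"
      unfolding z_def z'_def using p by (intro has_vector_derivative_diff dx dy) auto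
    from bounded_bilinear.has_vector_derivative[OF bounded_bilinear_inner this this]
    have "((\<lambda>p. z p \<bullet> z p) has_real_derivative 2 * (z p \<bullet> z')) (at p within {s..q})"
      by (simp add: has_real_derivative_iff_has_vector_derivative inner_commute[of z'])
    moreover have "((\<lambda>p. exp (- (2 * L * (p - s)))) has_real_derivative
        exp (- (2 * L * (p - s))) * - (2 * L)) (at p within {s..q})"
      by (auto intro!: derivative_eq_intros)
    ultimately have "(w has_real_derivative exp (- (2 * L * (p - s))) * - (2 * L) * (z p \<bullet> z p) +
        2 * (z p \<bullet> z') * exp (- (2 * L * (p - s)))) (at p within {s..q})"
      unfolding w_def by (rule DERIV_mult[rotated])
    moreover have "exp (- (2 * L * (p - s))) * - (2 * L) * (z p \<bullet> z p) +
        2 * (z p \<bullet> z') * exp (- (2 * L * (p - s))) =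
        2 * exp (- (2 * L * (p - s))) * (z p \<bullet> z' - L * (norm (z p))\<^sup>2)"
      by (simp add: algebra_simps power2_norm_eq_inner)
    ultimately have "(w has_real_derivative
        2 * exp (- (2 * L * (p - s))) * (z p \<bullet> z' - L * (norm (z p))\<^sup>2)) (at p within {s..q})"
      by simp
    moreover have "z p \<bullet> z' \<le> L * (norm (z p))\<^sup>2"
      unfolding z_def z'_def using p sub d R by (intro L) auto
    then have "2 * exp (- (2 * L * (p - s))) * (z p \<bullet> z' - L * (norm (z p))\<^sup>2) \<le> 0"
      by (simp add: mult_nonneg_nonpos)
    ultimately show ?thesis
      by blast
  qed
  ultimately have "w q \<le> w s"
    by (rule abs_continuous_on_nonpos_derivative[OF \<open>s \<le> q\<close>])
  then have "w q \<le> 0"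
    using \<open>x s = y s\<close> by (simp add: w_def z_def)
  then have "z q = 0"
    by (simp add: w_def mult_le_0_iff power2_norm_eq_inner[symmetric])
  then show ?thesis
    by (simp add: z_def)
qed

section \<open>Comparison functions\<close>

lemma class_N_nonneg: "class_N g \<Longrightarrow> 0 \<le> s \<Longrightarrow> 0 \<le> g s"
  unfolding class_N_def by (metis atLeast_iff mono_onD order_refl)

lemma class_N_mono: "class_N g \<Longrightarrow> 0 \<le> s \<Longrightarrow> s \<le> t \<Longrightarrow> g s \<le> g t"
  unfolding class_N_def by (meson atLeast_iff mono_onD order_trans)

lemma class_K_mono: "class_K g \<Longrightarrow> 0 \<le> s \<Longrightarrow> s \<le> t \<Longrightarrow> g s \<le> g t"
  unfolding class_K_def by (cases "s = t") (auto dest: strict_mono_onD[of _ _ s t])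

lemma class_K_nonneg: "class_K g \<Longrightarrow> 0 \<le> s \<Longrightarrow> 0 \<le> g s"
  using class_K_mono[of g 0 s] by (simp add: class_K_def)

text \<open>Shapes the growth bound of the switched feedback: one summand per branch, the sum
  dominating both. Strict growth and unboundedness are inherited from \<open>g\<close>.\<close>

lemma class_K_inf_add_scaled:
  assumes g: "class_K_inf g" and p: "class_K p" and "0 < m"
  shows "class_K_inf (\<lambda>s. g s + p (m * s))"
proof -
  have K: "class_K g"
    using g by (simp add: class_K_inf_def)
  have "continuous_on {0..} (\<lambda>s. p (m * s))"
  proof (rule continuous_on_compose2[of "{0..}" p])
    show "continuous_on {0..} p"
      using p by (simp add: class_K_def)
    show "continuous_on {0..} (\<lambda>s. m * s)"
      by (intro continuous_intros)
  qed (use \<open>0 < m\<close> in auto)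
  then have "continuous_on {0..} (\<lambda>s. g s + p (m * s))"
    using K by (intro continuous_on_add) (simp_all add: class_K_def)
  moreover have "strict_mono_on {0..} (\<lambda>s. g s + p (m * s))"
  proof (rule strict_mono_onI)
    fix s t :: real assume st: "s \<in> {0..}" "t \<in> {0..}" "s < t"
    have "g s < g t"
      using K st by (auto simp: class_K_def dest: strict_mono_onD[of _ _ s t])
    moreover have "p (m * s) \<le> p (m * t)"
      using st \<open>0 < m\<close> by (intro class_K_mono[OF p]) auto
    ultimately show "g s + p (m * s) < g t + p (m * t)"
      by simp
  qed
  moreover have "\<not> bounded ((\<lambda>s. g s + p (m * s)) ` {0..})"
  proof
    assume "bounded ((\<lambda>s. g s + p (m * s)) ` {0..})"
    then obtain B where B: "\<And>s. 0 \<le> s \<Longrightarrow> \<bar>g s + p (m * s)\<bar> \<le> B"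
      unfolding bounded_iff by fastforce
    have "norm (g s) \<le> B" if "0 \<le> s" for s
      using B[OF that] class_K_nonneg[OF K that] class_K_nonneg[OF p, of "m * s"] that \<open>0 < m\<close> by simp
    then have "bounded (g ` {0..})"
      unfolding bounded_iff by blast
    then show False
      using g by (simp add: class_K_inf_def)
  qed
  ultimately show ?thesis
    using K p by (simp add: class_K_inf_def class_K_def)
qed

lemma class_KL_mono:
  assumes "class_KL \<sigma>" "0 \<le> s" "s \<le> s'" "0 \<le> t'" "t' \<le> t"
  shows "\<sigma> s t \<le> \<sigma> s' t'"
proof -
  have "strict_mono_on {0..} (\<lambda>s. \<sigma> s t)"
    using assms by (simp add: class_KL_def class_K_def)
  then have "\<sigma> s t \<le> \<sigma> s' t"
    using assms by (cases "s = s'") (auto dest!: strict_mono_onD[of _ _ s s'])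
  also have "antimono_on {0..} (\<sigma> s')"
    using assms by (simp add: class_KL_def)
  then have "\<sigma> s' t \<le> \<sigma> s' t'"
    using assms by (auto dest!: monotone_onD[of _ _ _ _ t' t])
  finally show ?thesis .
qed

text \<open>The delay \<open>C\<close> and the transient bound \<open>M\<close> are absorbed into a class \<open>KL\<close> bound: the exponential
  term dominates \<open>M s\<close> up to time \<open>C s\<close>.\<close>

lemma class_KL_delayed:
  assumes \<sigma>: "class_KL \<sigma>" and M: "class_N M"
    and C: "continuous_on {0..} C" "mono_on {0..} C"
  shows "class_KL (\<lambda>s t. \<sigma> (s + M s) (max 0 (t - C s)) + M s * exp (C s - t))"
proof -
  have C_mono: "C s \<le> C s'" if "0 \<le> s" "s \<le> s'" for s s'
    using C(2) that by (auto intro: mono_onD)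
  have M_cont: "continuous_on {0..} M"
    using M by (simp add: class_N_def)
  note M_nonneg = class_N_nonneg[OF M] and M_mono = class_N_mono[OF M]
  have \<sigma>_cont: "continuous_on ({0..} \<times> {0..}) (\<lambda>(s, t). \<sigma> s t)"
    using \<sigma> by (simp add: class_KL_def)
  have cont: "continuous_on ({0..} \<times> {0..})
      (\<lambda>p. \<sigma> (fst p + M (fst p)) (max 0 (snd p - C (fst p))) + M (fst p) * exp (C (fst p) - snd p))"
  proof -
    have 1: "continuous_on ({0..} \<times> {0..}) (\<lambda>p::real \<times> real. g (fst p))"
      if "continuous_on {0..} g" for g :: "real \<Rightarrow> real"
      by (rule continuous_on_compose2[OF that continuous_on_fst[OF continuous_on_id]]) auto
    note MC = 1[OF M_cont] 1[OF C(1)]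
    have 2: "continuous_on ({0..} \<times> {0..})
        (\<lambda>p. (fst p + M (fst p), max 0 (snd p - C (fst p))))"
      by (intro continuous_on_Pair continuous_on_add continuous_on_max continuous_on_diff
          continuous_on_const continuous_on_fst continuous_on_snd continuous_on_id MC)
    have 3: "(\<lambda>p. (fst p + M (fst p), max 0 (snd p - C (fst p)))) ` ({0..} \<times> {0..}) \<subseteq> {0..} \<times> {0..}"
      by (clarsimp simp: M_nonneg)
    from continuous_on_compose2[OF \<sigma>_cont 2 3]
    have "continuous_on ({0..} \<times> {0..}) (\<lambda>p. \<sigma> (fst p + M (fst p)) (max 0 (snd p - C (fst p))))"
      by simp
    then show ?thesis
      by (intro continuous_on_add continuous_on_mult continuous_on_exp continuous_on_diff
          continuous_on_snd continuous_on_id MC)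
  qed
  have K: "class_K (\<lambda>s. \<sigma> (s + M s) (max 0 (t - C s)) + M s * exp (C s - t))" if "t \<ge> 0" for t
    unfolding class_K_def
  proof (intro conjI)
    show "continuous_on {0..} (\<lambda>s. \<sigma> (s + M s) (max 0 (t - C s)) + M s * exp (C s - t))"
    proof -
      have "continuous_on {0..} (\<lambda>s. (s, t))" "(\<lambda>s. (s, t)) ` {0..} \<subseteq> {0..} \<times> {0..}"
        using that by (auto intro!: continuous_intros)
      from continuous_on_compose2[OF cont this] show ?thesis
        by simp
    qed
    have "\<sigma> (s + M s) (max 0 (t - C s)) + M s * exp (C s - t) <
        \<sigma> (s' + M s') (max 0 (t - C s')) + M s' * exp (C s' - t)" if "0 \<le> s" "s < s'" for s s'
    proof -
      \<comment> \<open>With the delay frozen at \<open>s'\<close>, strict growth comes from the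
        summand \<open>s\<close> in \<open>s + M s\<close>, as \<open>M\<close> is merely
        non-decreasing.\<close>
      have "strict_mono_on {0..} (\<lambda>s. \<sigma> s (max 0 (t - C s')))"
        using \<sigma> unfolding class_KL_def class_K_def by (meson max.cobounded1)
      then have "\<sigma> (s + M s) (max 0 (t - C s')) < \<sigma> (s' + M s') (max 0 (t - C s'))"
        using that M_nonneg[of s] M_nonneg[of s'] M_mono[of s s'] by (auto elim!: strict_mono_onD)
      moreover have "\<sigma> (s + M s) (max 0 (t - C s)) \<le> \<sigma> (s + M s) (max 0 (t - C s'))"
        using that M_nonneg[of s] C_mono[of s s'] by (intro class_KL_mono[OF \<sigma>]) auto
      moreover have "M s * exp (C s - t) \<le> M s' * exp (C s' - t)"
        using that M_nonneg[of s'] M_mono[of s s'] C_mono[of s s'] by (intro mult_mono) auto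
      ultimately show ?thesis
        by linarith
    qed
    then show "strict_mono_on {0..} (\<lambda>s. \<sigma> (s + M s) (max 0 (t - C s)) + M s * exp (C s - t))"
      by (intro strict_mono_onI) auto
    have "\<sigma> 0 (max 0 (t - C 0)) = 0"
      using \<sigma> unfolding class_KL_def class_K_def by (meson max.cobounded1)
    then show "\<sigma> (0 + M 0) (max 0 (t - C 0)) + M 0 * exp (C 0 - t) = 0"
      using M by (simp add: class_N_def)
  qed
  have anti: "antimono_on {0..} (\<lambda>t. \<sigma> (s + M s) (max 0 (t - C s)) + M s * exp (C s - t))"
    if "s \<ge> 0" for s
    using that M_nonneg[of s]
    by (intro monotone_onI add_mono class_KL_mono[OF \<sigma>] mult_left_mono) auto
  have lim: "((\<lambda>t. \<sigma> (s + M s) (max 0 (t - C s)) + M s * exp (C s - t)) \<longlongrightarrow> 0) at_top"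
    if "s \<ge> 0" for s
  proof -
    have "(\<sigma> (s + M s) \<longlongrightarrow> 0) at_top"
      using \<sigma> that M_nonneg[of s] unfolding class_KL_def by simp
    moreover have "filterlim (\<lambda>t. max 0 (t - C s)) at_top at_top"
      by (rule filterlim_at_top_mono[of "\<lambda>t. t - C s"])
         (auto intro!: filterlim_tendsto_add_at_top[of "\<lambda>_. - C s", simplified] filterlim_ident)
    ultimately have 1: "((\<lambda>t. \<sigma> (s + M s) (max 0 (t - C s))) \<longlongrightarrow> 0) at_top"
      by (rule filterlim_compose)
    have "((\<lambda>t. exp (C s) * exp (- t)) \<longlongrightarrow> exp (C s) * 0) at_top"
      by (intro tendsto_mult tendsto_const filterlim_compose[OF exp_at_bot] filterlim_uminus_at_bot_at_top)
    then have "((\<lambda>t. exp (C s - t)) \<longlongrightarrow> 0) at_top"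
      by (simp add: exp_add[symmetric])
    from tendsto_add[OF 1 tendsto_mult[OF tendsto_const[of "M s"] this]] show ?thesis
      by simp
  qed
  show ?thesis
    using cont K anti lim by (simp add: class_KL_def case_prod_beta)
qed

section \<open>Sampling\<close>

lemma sample_time_less_Suc: "0 < h \<Longrightarrow> sample_time h e i < sample_time h e (Suc i)"
  by simp

lemma sample_time_mono: "0 < h \<Longrightarrow> i \<le> j \<Longrightarrow> sample_time h e i \<le> sample_time h e j"
  by (rule lift_Suc_mono_le) (auto intro: less_imp_le)

lemma sample_time_nonneg: "0 < h \<Longrightarrow> 0 \<le> sample_time h e i"
  using sample_time_mono[of h 0 i e] by simp

lemma sample_time_Suc_le:
  assumes "e \<in> sampling_inputs" "0 < h"
  shows "sample_time h e (Suc i) \<le> sample_time h e i + h"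
proof -
  have "0 \<le> e (sample_time h e i)"
    using assms sample_time_nonneg[OF assms(2), of e i] by (simp add: sampling_inputs_def)
  then show ?thesis
    using assms(2) by simp
qed

text \<open>Local boundedness of the input keeps the sampling steps away from \<open>0\<close> on bounded time
  intervals.\<close>

lemma sample_time_unbounded:
  assumes e: "e \<in> sampling_inputs" and h: "0 < h"
  shows "\<exists>i. t < sample_time h e i"
proof (rule ccontr)
  assume "\<not> ?thesis"
  then have le: "sample_time h e i \<le> t" for i
    by (simp add: not_less)
  have "bounded (e ` {0..t})"
    using e by (auto simp: sampling_inputs_def locally_bounded_on_def)
  then obtain B where B: "\<And>q. 0 \<le> q \<Longrightarrow> q \<le> t \<Longrightarrow> \<bar>e q\<bar> \<le> B"
    unfolding bounded_iff by fastforce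
  have "real i * (h * exp (- B)) \<le> sample_time h e i" for i
  proof (induction i)
    case (Suc i)
    have "h * exp (- B) \<le> h * exp (- e (sample_time h e i))"
      using B[OF sample_time_nonneg[OF h] le, of i] h by simp
    then show ?case
      using Suc by (simp add: algebra_simps)
  qed simp
  then have "real i * (h * exp (- B)) \<le> t" for i
    using le order_trans by blast
  moreover obtain i where "t < real i * (h * exp (- B))"
    using reals_Archimedean3[of "h * exp (- B)"] h by (meson exp_gt_zero mult_pos_pos)
  ultimately show False
    by (meson not_less)
qed

text \<open>Because \<open>exp (- ln (h' / h))\<close> is \<open>h / h'\<close>, the added constant
  turns steps of period \<open>h'\<close> into steps of period \<open>h\<close>. From its
  \<open>n\<close>-th sampling time on, a sampled-data system is thus again one, with another period
  and a shifted input; the constant is nonnegative when \<open>h \<le> h'\<close>.\<close>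

lemma sample_time_shift:
  assumes "0 < h" "0 < h'"
  shows "sample_time h e (n + i) = sample_time h e n +
    sample_time h' (\<lambda>t. e (sample_time h e n + t) + ln (h' / h)) i"
proof (induction i)
  case (Suc i)
  have "h' * exp (- (y + ln (h' / h))) = h * exp (- y)" for y
    using assms by (simp add: exp_diff exp_minus field_simps)
  then show ?case
    using Suc by simp
qed simp

text \<open>Since steps are available from all states, they can be chosen first and the states at
  the sampling times then computed by recursion. Neighbouring pieces agree at their common sampling
  time, so one function solves on all the closed intervals.\<close>

lemma sampled_solution_exists:
  fixes f :: "'d \<Rightarrow> 'x::euclidean_space \<Rightarrow> 'u \<Rightarrow> 'x"
  assumes "0 < h"
    and step: "\<And>i z. \<exists>y. y (sample_time h e i) = z \<and>
      solves_const f d (k z) (sample_time h e i) (sample_time h e (Suc i)) y"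
  shows "\<exists>x. sampled_solution f d k h e x0 x"
proof -
  let ?\<tau> = "sample_time h e"
  obtain Y where Y: "\<And>i z. Y i z (?\<tau> i) = z"
    "\<And>i z. solves_const f d (k z) (?\<tau> i) (?\<tau> (Suc i)) (Y i z)"
    using step by metis
  define z where "z = rec_nat x0 (\<lambda>i zi. Y i zi (?\<tau> (Suc i)))"
  have z: "z 0 = x0" "z (Suc i) = Y i (z i) (?\<tau> (Suc i))" for i
    by (simp_all add: z_def)
  \<comment> \<open>The least index assigns a sampling time to the interval that ends there, except
    time 0, which gets index 0. \<open>x_knot\<close> reconciles this with the piece that starts
    there.\<close>
  define x where "x t = (let i = LEAST i. t \<le> ?\<tau> (Suc i) in Y i (z i) t)" for t
  have Least: "(LEAST i. t \<le> ?\<tau> (Suc i)) = i" if "?\<tau> i < t" "t \<le> ?\<tau> (Suc i)" for i t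
  proof (rule Least_equality)
    show "t \<le> ?\<tau> (Suc i)"
      by (rule that(2))
    fix j assume "t \<le> ?\<tau> (Suc j)"
    then have "\<not> Suc j \<le> i"
      using that(1) sample_time_mono[OF \<open>0 < h\<close>, of "Suc j" i e] by linarith
    then show "i \<le> j"
      by simp
  qed
  have x_knot: "x (?\<tau> i) = z i" for i
  proof (cases i)
    case 0
    have "(LEAST i. ?\<tau> 0 \<le> ?\<tau> (Suc i)) = 0"
      using \<open>0 < h\<close> by (intro Least_equality) simp_all
    then show ?thesis
      using Y(1)[of 0 x0] by (simp only: x_def 0 z Let_def)
  next
    case (Suc j)
    have "(LEAST i. ?\<tau> (Suc j) \<le> ?\<tau> (Suc i)) = j"
      using sample_time_less_Suc[OF \<open>0 < h\<close>] by (intro Least) auto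
    then show ?thesis
      by (simp only: x_def Suc z Let_def)
  qed
  have "x t = Y i (z i) t" if "t \<in> {?\<tau> i..?\<tau> (Suc i)}" for i t
  proof (cases "t = ?\<tau> i")
    case False
    then have "(LEAST i. t \<le> ?\<tau> (Suc i)) = i"
      using that by (intro Least) auto
    then show ?thesis
      by (simp only: x_def Let_def)
  qed (simp add: x_knot Y(1))
  then have "solves_const f d (k (x (?\<tau> i))) (?\<tau> i) (?\<tau> (Suc i)) x" for i
    unfolding x_knot by (intro solves_const_cong[OF Y(2)]) simp
  then show ?thesis
    using x_knot[of 0] z(1) unfolding sampled_solution_def by (intro exI[of _ x]) simp
qed

section \<open>The switched feedback\<close>

declare sample_time.simps(2) [simp del]

text \<open>P1 and P2 with their witnesses fixed, those of P2 as functions of the level, so that the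
  feedback can be defined from them. Boundedness and growth of the feedback do not concern the
  motions and are left to the theorem.\<close>

locale reachability_chain =
  fixes f :: "'d::euclidean_space \<Rightarrow> 'x::euclidean_space \<Rightarrow> 'u::euclidean_space \<Rightarrow> 'x"
    and D :: "'d set" and U :: "'u set"
    and k\<^sub>0 :: "'x \<Rightarrow> 'u" and h\<^sub>0 :: real and \<sigma> :: "real \<Rightarrow> real \<Rightarrow> real"
    and r :: real and N :: nat and \<Omega> :: "nat \<Rightarrow> 'x set"
    and v :: "nat \<Rightarrow> 'u" and c :: "nat \<Rightarrow> real" and a b :: "nat \<Rightarrow> real \<Rightarrow> real"
  assumes H1: "H1 f D U"
    and k0_U: "range k\<^sub>0 \<subseteq> U" and h0_pos: "0 < h\<^sub>0" and KL: "class_KL \<sigma>"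
    and local_ex: "\<And>x0 d e. x0 \<in> \<Omega> 1 \<Longrightarrow> d \<in> Linf_loc D \<Longrightarrow> e \<in> sampling_inputs \<Longrightarrow>
      \<exists>x. sampled_solution f d k\<^sub>0 h\<^sub>0 e x0 x"
    and local_bound: "\<And>x0 d e x t. x0 \<in> \<Omega> 1 \<Longrightarrow> d \<in> Linf_loc D \<Longrightarrow> e \<in> sampling_inputs \<Longrightarrow>
      sampled_solution f d k\<^sub>0 h\<^sub>0 e x0 x \<Longrightarrow> 0 \<le> t \<Longrightarrow> norm (x t) \<le> \<sigma> (norm x0) t \<and> x t \<in> \<Omega> 1"
    and r_pos: "0 < r" and cover: "(\<Union>j\<in>{1..N}. \<Omega> j) = UNIV"
    and v_U: "\<And>j. j \<in> {2..N} \<Longrightarrow> v j \<in> U"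
    and c_nonneg: "\<And>j. j \<in> {2..N} \<Longrightarrow> 0 \<le> c j"
    and a_N: "\<And>j. j \<in> {2..N} \<Longrightarrow> class_N (a j)"
    and b_N: "\<And>j. j \<in> {2..N} \<Longrightarrow> class_N (b j)"
    and reach: "\<And>j x0 d. j \<in> {2..N} \<Longrightarrow> x0 \<in> \<Omega> j \<Longrightarrow> d \<in> Linf_loc D \<Longrightarrow>
      \<exists>T. 0 \<le> T \<and> T \<le> c j + b j (norm x0) \<and>
        (\<exists>x. x 0 = x0 \<and> solves_const f d (v j) 0 (T + r) x) \<and>
        (\<forall>x. x 0 = x0 \<and> solves_const f d (v j) 0 (T + r) x \<longrightarrow>
          (\<forall>t\<in>{0..T + r}. norm (x t) \<le> a j (norm x0)) \<and>
          (\<forall>t\<in>{T..T + r}. x t \<in> (\<Union>i\<in>{1..j - 1}. \<Omega> i)) \<and>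
          (\<forall>t\<in>{0..T}. x t \<in> \<Omega> j))"
begin

section \<open>The feedback and existence of closed-loop motions\<close>

definition level :: "'x \<Rightarrow> nat" where
  "level z = (LEAST j. 1 \<le> j \<and> z \<in> \<Omega> j)"

definition feedback :: "'x \<Rightarrow> 'u" where
  "feedback z = (if z \<in> \<Omega> 1 then k\<^sub>0 z else v (level z))"

definition period :: real where
  "period = min h\<^sub>0 r"

lemma period: "0 < period" "period \<le> h\<^sub>0" "period \<le> r"
  using h0_pos r_pos by (auto simp: period_def)

lemma level:
  assumes "z \<notin> \<Omega> 1"
  shows "level z \<in> {2..N}" "z \<in> \<Omega> (level z)"
proof -
  obtain j where j: "j \<in> {1..N}" "z \<in> \<Omega> j"
    using cover by blast
  then have "1 \<le> level z \<and> z \<in> \<Omega> (level z)"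
    unfolding level_def by (metis (mono_tags, lifting) LeastI_ex atLeastAtMost_iff)
  moreover from this have "level z \<noteq> 1"
    using assms by metis
  \<comment> \<open>\<open>level\<close> is not capped at \<open>N\<close>, and sets with larger
    index are unconstrained; the cover supplies the cap.\<close>
  moreover have "level z \<le> j"
    unfolding level_def using j by (simp add: Least_le)
  ultimately show "level z \<in> {2..N}" "z \<in> \<Omega> (level z)"
    using j by auto
qed

text \<open>As long as a motion started in \<open>\<Omega> j\<close> has not met the lower sets, its
  level is exactly \<open>j\<close>, so the control does not change.\<close>

lemma level_eqI:
  assumes "1 \<le> j" "z \<in> \<Omega> j" "z \<notin> (\<Union>i\<in>{1..j - 1}. \<Omega> i)"
  shows "level z = j"
  unfolding level_def
proof (rule Least_equality)
  fix i assume "1 \<le> i \<and> z \<in> \<Omega> i"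
  then have "\<not> i \<le> j - 1"
    using assms(3) by auto
  then show "j \<le> i"
    by simp
qed (use assms in simp)

lemma feedback_U: "feedback z \<in> U"
  using k0_U v_U level(1)[of z] by (auto simp: feedback_def)

text \<open>In \<open>\<Omega> 1\<close> the step is the first one of a local solution whose input
  is adjusted to give the right length. Elsewhere the supplied motion lasts \<open>T + r\<close>,
  which is at least one period.\<close>

lemma feedback_step:
  assumes d: "d \<in> Linf_loc D" and e: "e \<in> sampling_inputs"
  shows "\<exists>y. y (sample_time period e i) = z \<and> solves_const f d (feedback z)
    (sample_time period e i) (sample_time period e (Suc i)) y"
proof -
  let ?\<tau> = "sample_time period e"
  let ?d = "\<lambda>t. d (?\<tau> i + t)"
  have \<tau>: "0 \<le> ?\<tau> i" "?\<tau> i \<le> ?\<tau> (Suc i)" "?\<tau> (Suc i) \<le> ?\<tau> i + period"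
    using sample_time_nonneg sample_time_mono[of period i "Suc i" e] sample_time_Suc_le[OF e, of period i] period by auto
  have d': "?d \<in> Linf_loc D"
    by (rule Linf_loc_shift[OF d \<tau>(1)])
  have "\<exists>y. y 0 = z \<and> solves_const f ?d (feedback z) 0 (?\<tau> (Suc i) - ?\<tau> i) y"
  proof (cases "z \<in> \<Omega> 1")
    case True
    let ?e = "\<lambda>t. e (?\<tau> i + t) + ln (h\<^sub>0 / period)"
    have "?e \<in> sampling_inputs"
      using period by (intro sampling_inputs_shift_add[OF e \<tau>(1)]) simp
    from local_ex[OF True d' this] obtain y where y: "sampled_solution f ?d k\<^sub>0 h\<^sub>0 ?e z y"
      by blast
    have "y 0 = z"
      using y by (simp add: sampled_solution_def)
    moreover have "solves_const f ?d (k\<^sub>0 (y (sample_time h\<^sub>0 ?e 0))) (sample_time h\<^sub>0 ?e 0)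
        (sample_time h\<^sub>0 ?e (Suc 0)) y"
      using y unfolding sampled_solution_def by blast
    moreover have "sample_time h\<^sub>0 ?e (Suc 0) = ?\<tau> (Suc i) - ?\<tau> i"
      using sample_time_shift[OF period(1) h0_pos, of e i "Suc 0"] by simp
    ultimately show ?thesis
      using True by (auto simp: feedback_def)
  next
    case False
    from reach[OF level(1,2)[OF False] d'] obtain T y where "0 \<le> T" "y 0 = z"
      "solves_const f ?d (v (level z)) 0 (T + r) y"
      by blast
    moreover from this have "solves_const f ?d (v (level z)) 0 (?\<tau> (Suc i) - ?\<tau> i) y"
      using \<tau> period by (elim solves_const_subinterval) auto
    ultimately show ?thesis
      using False by (auto simp: feedback_def)
  qed
  then obtain y where "y 0 = z" "solves_const f ?d (feedback z) 0 (?\<tau> (Suc i) - ?\<tau> i) y"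
    by blast
  then show ?thesis
    using solves_const_translation_iff[of f d "?\<tau> i" "feedback z" 0 "?\<tau> (Suc i) - ?\<tau> i" "\<lambda>t. y (t - ?\<tau> i)"]
    by (intro exI[of _ "\<lambda>t. y (t - ?\<tau> i)"]) simp
qed

lemma feedback_solution_exists:
  "d \<in> Linf_loc D \<Longrightarrow> e \<in> sampling_inputs \<Longrightarrow> \<exists>x. sampled_solution f d feedback period e x0 x"
  by (intro sampled_solution_exists period(1) feedback_step)

section \<open>Descent through the levels and the motion after entry\<close>

lemma solves_const_unique_nonneg:
  assumes "u \<in> U" "d \<in> Linf_loc D" "0 \<le> s" "solves_const f d u s t x" "solves_const f d u s t y"
    "x s = y s" "q \<in> {s..t}"
  shows "x q = y q"
  by (rule solves_const_unique[OF H1 assms(1) _ assms(4-7)]) (use assms(2,3) in \<open>auto simp: Linf_loc_def\<close>)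

text \<open>Since the period is at most \<open>r\<close>, a sampling time falls into the time window of length \<open>r\<close>
  which the motion with constant control spends in the lower levels; until then uniqueness of
  solutions identifies the sampled motion with that motion.\<close>

lemma descent:
  assumes x: "sampled_solution f d feedback period e x0 x"
    and d: "d \<in> Linf_loc D" and e: "e \<in> sampling_inputs" and j: "j \<in> {2..N}"
    and x_n: "x (sample_time period e n) \<in> \<Omega> j"
      "x (sample_time period e n) \<notin> (\<Union>i\<in>{1..j - 1}. \<Omega> i)"
  obtains m where "n \<le> m" "x (sample_time period e m) \<in> (\<Union>i\<in>{1..j - 1}. \<Omega> i)"
    "sample_time period e m - sample_time period e n \<le> c j + b j (norm (x (sample_time period e n))) + r"
    "\<And>t. t \<in> {sample_time period e n..sample_time period e m} \<Longrightarrow>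
      norm (x t) \<le> a j (norm (x (sample_time period e n)))"
proof -
  let ?\<tau> = "sample_time period e" and ?A = "\<Union>i\<in>{1..j - 1}. \<Omega> i"
  let ?d = "\<lambda>t. d (?\<tau> n + t)"
  note \<tau>_nonneg = sample_time_nonneg[OF period(1), of e]
    and \<tau>_mono = sample_time_mono[OF period(1), of _ _ e]
  obtain T y0 where T: "0 \<le> T" "T \<le> c j + b j (norm (x (?\<tau> n)))"
    and y0: "y0 0 = x (?\<tau> n)" "solves_const f ?d (v j) 0 (T + r) y0"
    and y0_bd: "\<And>t. t \<in> {0..T + r} \<Longrightarrow> norm (y0 t) \<le> a j (norm (x (?\<tau> n)))"
    and y0_A: "\<And>t. t \<in> {T..T + r} \<Longrightarrow> y0 t \<in> ?A"
    and y0_\<Omega>: "\<And>t. t \<in> {0..T} \<Longrightarrow> y0 t \<in> \<Omega> j"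
    using reach[OF j x_n(1) Linf_loc_shift[OF d \<tau>_nonneg, of n]] by blast
  define y where "y t = y0 (t - ?\<tau> n)" for t
  have y: "solves_const f d (v j) (?\<tau> n) (?\<tau> n + (T + r)) y"
    using solves_const_translation_iff[of f d "?\<tau> n" "v j" 0 "T + r" y] y0(2) by (simp add: y_def)
  \<comment> \<open>The second alternative guarantees that such an index exists, sampling times
    being unbounded. At the least one the elapsed time is at most \<open>T + r\<close>: unless it is
    \<open>n\<close> itself, the elapsed time was below \<open>T\<close> one step earlier, and a
    step takes at most \<open>r\<close>.\<close>
  let ?P = "\<lambda>i. n \<le> i \<and> (x (?\<tau> i) \<in> ?A \<or> T \<le> ?\<tau> i - ?\<tau> n)"
  obtain i0 where i0: "?\<tau> n + T < ?\<tau> i0"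
    using sample_time_unbounded[OF e period(1)] by blast
  have "?P i0"
    using i0 T(1) \<tau>_mono[of i0 n] by (cases "n \<le> i0") auto
  define l where "l = (LEAST i. ?P i)"
  have l: "?P l"
    unfolding l_def by (rule LeastI[of ?P, OF \<open>?P i0\<close>])
  have not_P: "\<not> ?P i" if "i < l" for i
    using not_less_Least[of i ?P] that unfolding l_def by blast
  have eq: "?\<tau> i - ?\<tau> n \<le> T + r \<and> (\<forall>q\<in>{?\<tau> n..?\<tau> i}. x q = y q)" if "n \<le> i" "i \<le> l" for i
    using that
  proof (induction i rule: nat_induct_at_least)
    case base
    then show ?case
      using T(1) r_pos by (simp add: y_def y0(1))
  next
    case (Suc i)
    then have "\<not> ?P i"
      using not_P[of i] by simp
    then have i: "?\<tau> i - ?\<tau> n < T" "x (?\<tau> i) \<notin> ?A"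
      using Suc.hyps by auto
    have le: "?\<tau> n \<le> ?\<tau> i" "?\<tau> i \<le> ?\<tau> (Suc i)" "?\<tau> (Suc i) \<le> ?\<tau> i + period"
      using \<tau>_mono[of n i] \<tau>_mono[of i "Suc i"] Suc.hyps sample_time_Suc_le[OF e period(1)] by auto
    have xy: "x (?\<tau> i) = y (?\<tau> i)"
      using Suc le by auto
    then have "x (?\<tau> i) \<in> \<Omega> j"
      using y0_\<Omega>[of "?\<tau> i - ?\<tau> n"] i(1) le(1) by (simp add: y_def)
    then have "level (x (?\<tau> i)) = j"
      using level_eqI[of j] i(2) j by auto
    \<comment> \<open>As \<open>j\<close> is at least 2, \<open>\<Omega> 1\<close> is among the
      lower sets.\<close>
    moreover have "x (?\<tau> i) \<notin> \<Omega> 1"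
      using i(2) j by auto
    ultimately have "feedback (x (?\<tau> i)) = v j"
      by (simp add: feedback_def)
    then have "solves_const f d (v j) (?\<tau> i) (?\<tau> (Suc i)) x"
      using x unfolding sampled_solution_def by metis
    moreover have *: "?\<tau> (Suc i) \<le> ?\<tau> n + (T + r)"
      using i(1) le(3) period(3) by linarith
    then have "solves_const f d (v j) (?\<tau> i) (?\<tau> (Suc i)) y"
      by (rule solves_const_subinterval[OF y le(1)])
    ultimately have "x q = y q" if "q \<in> {?\<tau> i..?\<tau> (Suc i)}" for q
      using solves_const_unique_nonneg[OF v_U[OF j] d \<tau>_nonneg] xy that by blast
    moreover have "x q = y q" if "q \<in> {?\<tau> n..?\<tau> i}" for q
      using Suc that by auto
    ultimately show ?case
      using * by (metis atLeastAtMost_iff diff_le_eq add.commute linear)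
  qed
  have le: "?\<tau> n \<le> ?\<tau> l"
    using l \<tau>_mono by blast
  have eq_l: "?\<tau> l - ?\<tau> n \<le> T + r" "\<And>q. q \<in> {?\<tau> n..?\<tau> l} \<Longrightarrow> x q = y0 (q - ?\<tau> n)"
    using eq[of l] l by (auto simp: y_def)
  show thesis
  proof (rule that)
    show "n \<le> l"
      using l by blast
    \<comment> \<open>Either the stop at \<open>l\<close> was caused by the lower sets, or the
      elapsed time lies between \<open>T\<close> and \<open>T + r\<close>, where the
      constant-control motion is in them.\<close>
    show "x (?\<tau> l) \<in> ?A"
      using l y0_A[of "?\<tau> l - ?\<tau> n"] eq_l(1) eq_l(2)[of "?\<tau> l"] le by auto
    show "?\<tau> l - ?\<tau> n \<le> c j + b j (norm (x (?\<tau> n))) + r"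
      using eq_l(1) T(2) by linarith
    show "norm (x t) \<le> a j (norm (x (?\<tau> n)))" if "t \<in> {?\<tau> n..?\<tau> l}" for t
      using eq_l(2)[OF that] y0_bd[of "t - ?\<tau> n"] eq_l(1) that by auto
  qed
qed

text \<open>Invariance of \<open>\<Omega> 1\<close> under the local motion is decisive: at every
  later sampling time \<open>feedback\<close> again selects \<open>k\<^sub>0\<close>, so uniqueness
  identifies the motion with a local solution one interval after the other.\<close>

lemma bound_after_entry:
  assumes x: "sampled_solution f d feedback period e x0 x"
    and d: "d \<in> Linf_loc D" and e: "e \<in> sampling_inputs"
    and x_m: "x (sample_time period e m) \<in> \<Omega> 1" and t: "sample_time period e m \<le> t"
  shows "norm (x t) \<le> \<sigma> (norm (x (sample_time period e m))) (t - sample_time period e m)"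
proof -
  let ?\<tau> = "sample_time period e"
  let ?d = "\<lambda>t. d (?\<tau> m + t)" and ?e = "\<lambda>t. e (?\<tau> m + t) + ln (h\<^sub>0 / period)"
  let ?\<rho> = "sample_time h\<^sub>0 ?e"
  note \<tau>_nonneg = sample_time_nonneg[OF period(1), of e]
    and \<tau>_mono = sample_time_mono[OF period(1), of _ _ e]
  have d': "?d \<in> Linf_loc D"
    by (rule Linf_loc_shift[OF d \<tau>_nonneg])
  have e': "?e \<in> sampling_inputs"
    using period by (intro sampling_inputs_shift_add[OF e \<tau>_nonneg]) simp
  obtain z where z: "sampled_solution f ?d k\<^sub>0 h\<^sub>0 ?e (x (?\<tau> m)) z"
    using local_ex[OF x_m d' e'] by blast
  note z_bd = local_bound[OF x_m d' e' z]
  have \<rho>: "?\<tau> (m + i) = ?\<tau> m + ?\<rho> i" for i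
    by (rule sample_time_shift[OF period(1) h0_pos])
  define y where "y t = z (t - ?\<tau> m)" for t
  have "\<forall>q\<in>{?\<tau> m..?\<tau> (m + i)}. x q = y q" for i
  proof (induction i)
    case 0
    then show ?case
      using z by (simp add: y_def sampled_solution_def)
  next
    case (Suc i)
    have xy: "x (?\<tau> (m + i)) = y (?\<tau> (m + i))"
      using Suc \<tau>_mono[of m "m + i"] by simp
    have yz: "y (?\<tau> (m + i)) = z (?\<rho> i)"
      by (simp add: y_def \<rho>)
    have "z (?\<rho> i) \<in> \<Omega> 1"
      using z_bd sample_time_nonneg[OF h0_pos] by blast
    then have fb: "feedback (x (?\<tau> (m + i))) = k\<^sub>0 (z (?\<rho> i))"
      using xy yz by (simp add: feedback_def)
    have "solves_const f d (feedback (x (?\<tau> (m + i)))) (?\<tau> (m + i)) (?\<tau> (Suc (m + i))) x"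
      using x unfolding sampled_solution_def by blast
    then have sx: "solves_const f d (k\<^sub>0 (z (?\<rho> i))) (?\<tau> (m + i)) (?\<tau> (m + Suc i)) x"
      unfolding fb by simp
    have "solves_const f ?d (k\<^sub>0 (z (?\<rho> i))) (?\<rho> i) (?\<rho> (Suc i)) z"
      using z unfolding sampled_solution_def by blast
    then have sy: "solves_const f d (k\<^sub>0 (z (?\<rho> i))) (?\<tau> (m + i)) (?\<tau> (m + Suc i)) y"
      using solves_const_translation_iff[of f d "?\<tau> m" "k\<^sub>0 (z (?\<rho> i))" "?\<rho> i" "?\<rho> (Suc i)" y]
      unfolding \<rho> by (simp add: y_def)
    have "k\<^sub>0 (z (?\<rho> i)) \<in> U"
      using k0_U by blast
    then have "x q = y q" if "q \<in> {?\<tau> (m + i)..?\<tau> (m + Suc i)}" for q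
      using solves_const_unique_nonneg[OF _ d \<tau>_nonneg sx sy xy that] by blast
    then show ?case
      using Suc by (metis atLeastAtMost_iff linear)
  qed
  moreover obtain i where "t < ?\<tau> i"
    using sample_time_unbounded[OF e period(1)] by blast
  then have "t < ?\<tau> (m + i)"
    using \<tau>_mono[of i "m + i"] by simp
  ultimately have "x t = z (t - ?\<tau> m)"
    using t unfolding y_def by (meson atLeastAtMost_iff less_imp_le)
  then show ?thesis
    using z_bd[of "t - ?\<tau> m"] t by simp
qed

text \<open>Induction over the levels. The claim is made for every sampling index \<open>n\<close>,
  since after a descent the hypothesis is applied at a later instant, and for the union of the lower
  sets, since a descent may skip levels. \<open>C\<close> and \<open>M\<close> are chosen before the
  inputs, which makes them uniform.\<close>

lemma entry:
  assumes "1 \<le> j" "j \<le> N"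
  shows "\<exists>C M. continuous_on {0..} C \<and> mono_on {0..} C \<and> (\<forall>s\<ge>0. 0 \<le> C s) \<and> class_N M \<and>
    (\<forall>d\<in>Linf_loc D. \<forall>e\<in>sampling_inputs. \<forall>x0 x n. sampled_solution f d feedback period e x0 x \<longrightarrow>
      x (sample_time period e n) \<in> (\<Union>i\<in>{1..j}. \<Omega> i) \<longrightarrow>
      (\<exists>m\<ge>n. x (sample_time period e m) \<in> \<Omega> 1 \<and>
        sample_time period e m - sample_time period e n \<le> C (norm (x (sample_time period e n))) \<and>
        (\<forall>t\<in>{sample_time period e n..sample_time period e m}.
          norm (x t) \<le> M (norm (x (sample_time period e n))))))"
  using assms
proof (induction j rule: nat_induct_at_least)
  case base
  have "class_N (\<lambda>s. s)"
    by (auto simp: class_N_def intro: mono_onI)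
  then show ?case
    by - (rule exI[of _ "\<lambda>_. 0"], rule exI[of _ "\<lambda>s. s"], auto intro: mono_onI)
next
  case (Suc j)
  then obtain C M where C: "continuous_on {0..} C" "mono_on {0..} C" "\<And>s. 0 \<le> s \<Longrightarrow> 0 \<le> C s"
    and M: "class_N M"
    and IH: "\<And>d e x0 x n. d \<in> Linf_loc D \<Longrightarrow> e \<in> sampling_inputs \<Longrightarrow>
      sampled_solution f d feedback period e x0 x \<Longrightarrow>
      x (sample_time period e n) \<in> (\<Union>i\<in>{1..j}. \<Omega> i) \<Longrightarrow>
      (\<exists>m\<ge>n. x (sample_time period e m) \<in> \<Omega> 1 \<and>
        sample_time period e m - sample_time period e n \<le> C (norm (x (sample_time period e n))) \<and>
        (\<forall>t\<in>{sample_time period e n..sample_time period e m}.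
          norm (x t) \<le> M (norm (x (sample_time period e n)))))"
    by (metis Suc_leD)
  let ?J = "Suc j"
  have J: "?J \<in> {2..N}"
    using Suc by auto
  \<comment> \<open>After a descent the norm is at most \<open>a ?J s\<close>, where the earlier
    bounds are then evaluated. Sums cover both cases, with and without a descent, and preserve
    continuity and monotonicity.\<close>
  define C' where "C' s = C s + (c ?J + b ?J s + r + C (a ?J s))" for s
  define M' where "M' s = M s + (a ?J s + M (a ?J s))" for s
  note aN = a_N[OF J] and bN = b_N[OF J]
  note nonneg = class_N_nonneg[OF aN] class_N_nonneg[OF bN] class_N_nonneg[OF M] C(3) c_nonneg[OF J]
  have C_mono: "C s \<le> C s'" if "0 \<le> s" "s \<le> s'" for s s'
    using C(2) that by (auto intro: mono_onD)
  have a_range: "a ?J ` {0..} \<subseteq> {0..}"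
    using nonneg(1) by auto
  have cont: "continuous_on {0..} (a ?J)" "continuous_on {0..} (b ?J)" "continuous_on {0..} M"
    using aN bN M by (auto simp: class_N_def)
  have "continuous_on {0..} C'"
    unfolding C'_def
    by (intro continuous_on_add continuous_on_const C(1) cont continuous_on_compose2[OF C(1) cont(1) a_range])
  moreover have "mono_on {0..} C'"
    unfolding C'_def
    by (intro mono_onI add_mono C_mono class_N_mono[OF aN] class_N_mono[OF bN] order_refl)
       (auto intro: nonneg)
  moreover have "\<forall>s\<ge>0. 0 \<le> C' s"
    using nonneg r_pos by (auto simp: C'_def intro!: add_nonneg_nonneg)
  moreover have "class_N M'"
    unfolding class_N_def
  proof (intro conjI)
    show "continuous_on {0..} M'"
      unfolding M'_def by (intro continuous_on_add cont continuous_on_compose2[OF cont(3) cont(1) a_range])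
    show "mono_on {0..} M'"
      unfolding M'_def
      by (intro mono_onI add_mono class_N_mono[OF aN] class_N_mono[OF M]) (auto intro: nonneg)
    show "M' 0 = 0"
      using aN M by (simp add: M'_def class_N_def)
  qed
  moreover have "\<exists>m\<ge>n. x (sample_time period e m) \<in> \<Omega> 1 \<and>
        sample_time period e m - sample_time period e n \<le> C' (norm (x (sample_time period e n))) \<and>
        (\<forall>t\<in>{sample_time period e n..sample_time period e m}.
          norm (x t) \<le> M' (norm (x (sample_time period e n))))"
    if d: "d \<in> Linf_loc D" and e: "e \<in> sampling_inputs"
      and x: "sampled_solution f d feedback period e x0 x"
      and x_n: "x (sample_time period e n) \<in> (\<Union>i\<in>{1..?J}. \<Omega> i)" for d e x0 x n
  proof -
    let ?\<tau> = "sample_time period e"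
    define s where "s = norm (x (?\<tau> n))"
    have "0 \<le> s"
      by (simp add: s_def)
    then have ge: "C s \<le> C' s" "M s \<le> M' s" "a ?J s \<le> M' s" "M (a ?J s) \<le> M' s"
      "c ?J + b ?J s + r + C (a ?J s) \<le> C' s"
      using nonneg r_pos by (auto simp: C'_def M'_def)
    show ?thesis
    proof (cases "x (?\<tau> n) \<in> (\<Union>i\<in>{1..j}. \<Omega> i)")
      case True
      from IH[OF d e x this] show ?thesis
        using ge(1,2) unfolding s_def[symmetric] by (meson order_trans)
    next
      case False
      then have "x (?\<tau> n) \<in> \<Omega> ?J"
        using x_n by (auto simp: atLeastAtMostSuc_conv)
      then obtain l where l: "n \<le> l" "x (?\<tau> l) \<in> (\<Union>i\<in>{1..j}. \<Omega> i)"
        "?\<tau> l - ?\<tau> n \<le> c ?J + b ?J s + r"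
        "\<And>t. t \<in> {?\<tau> n..?\<tau> l} \<Longrightarrow> norm (x t) \<le> a ?J s"
        using descent[OF x d e J, of n] False unfolding s_def by auto
      from IH[OF d e x l(2)] obtain m where m: "l \<le> m" "x (?\<tau> m) \<in> \<Omega> 1"
        "?\<tau> m - ?\<tau> l \<le> C (norm (x (?\<tau> l)))"
        "\<And>t. t \<in> {?\<tau> l..?\<tau> m} \<Longrightarrow> norm (x t) \<le> M (norm (x (?\<tau> l)))"
        by blast
      have "?\<tau> n \<le> ?\<tau> l"
        by (rule sample_time_mono[OF period(1) l(1)])
      then have x_l: "norm (x (?\<tau> l)) \<le> a ?J s"
        using l(4) by simp
      have "?\<tau> m - ?\<tau> n \<le> C' s"
        using l(3) m(3) C_mono[OF _ x_l] ge(5) by simp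
      moreover have "norm (x t) \<le> M' s" if "t \<in> {?\<tau> n..?\<tau> m}" for t
      proof (cases "t \<le> ?\<tau> l")
        case True
        then show ?thesis
          using l(4)[of t] that ge(3) by simp
      next
        case False
        then show ?thesis
          using m(4)[of t] that ge(4) class_N_mono[OF M _ x_l] by simp
      qed
      ultimately show ?thesis
        using l(1) m(1,2) unfolding s_def[symmetric] by (meson order_trans)
    qed
  qed
  ultimately show ?case
    by - (rule exI[of _ C'], rule exI[of _ M'], blast)
qed

lemma feedback_KL_bound:
  "\<exists>\<sigma>'. class_KL \<sigma>' \<and> (\<forall>x0. \<forall>d\<in>Linf_loc D. \<forall>e\<in>sampling_inputs. \<forall>x.
    sampled_solution f d feedback period e x0 x \<longrightarrow> (\<forall>t\<ge>0. norm (x t) \<le> \<sigma>' (norm x0) t))"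
proof -
  \<comment> \<open>For \<open>N = 0\<close> the union would be empty and could not be the whole
    space.\<close>
  have "1 \<le> N"
    using cover by (cases N) auto
  then obtain C M where C: "continuous_on {0..} C" "mono_on {0..} C" "\<And>s. 0 \<le> s \<Longrightarrow> 0 \<le> C s"
    and M: "class_N M"
    and entry: "\<And>d e x0 x n. d \<in> Linf_loc D \<Longrightarrow> e \<in> sampling_inputs \<Longrightarrow>
      sampled_solution f d feedback period e x0 x \<Longrightarrow>
      (\<exists>m\<ge>n. x (sample_time period e m) \<in> \<Omega> 1 \<and>
        sample_time period e m - sample_time period e n \<le> C (norm (x (sample_time period e n))) \<and>
        (\<forall>t\<in>{sample_time period e n..sample_time period e m}.
          norm (x t) \<le> M (norm (x (sample_time period e n)))))"
    using entry[of N] unfolding cover by (metis UNIV_I order_refl)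
  let ?\<sigma> = "\<lambda>s t. \<sigma> (s + M s) (max 0 (t - C s)) + M s * exp (C s - t)"
  have "norm (x t) \<le> ?\<sigma> (norm x0) t"
    if d: "d \<in> Linf_loc D" and e: "e \<in> sampling_inputs"
      and x: "sampled_solution f d feedback period e x0 x" and "t \<ge> 0" for d e x0 x t
  proof -
    let ?\<tau> = "sample_time period e"
    define s where "s = norm x0"
    have s: "0 \<le> s" "0 \<le> M s" "0 \<le> C s"
      using class_N_nonneg[OF M] C(3) by (simp_all add: s_def)
    have "x (?\<tau> 0) = x0"
      using x by (simp add: sampled_solution_def)
    with entry[OF d e x, of 0] obtain m where m: "x (?\<tau> m) \<in> \<Omega> 1" "?\<tau> m \<le> C s"
      "\<And>t. t \<in> {0..?\<tau> m} \<Longrightarrow> norm (x t) \<le> M s"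
      by (auto simp: s_def)
    have \<sigma>_nonneg: "0 \<le> \<sigma> (s + M s) (max 0 (t - C s))"
    proof -
      have "\<sigma> 0 (max 0 (t - C s)) = 0"
        using KL by (simp add: class_KL_def class_K_def)
      then show ?thesis
        using class_KL_mono[OF KL, of 0 "s + M s" "max 0 (t - C s)" "max 0 (t - C s)"] s by simp
    qed
    show ?thesis
    proof (cases "t \<le> ?\<tau> m")
      case True
      have "M s * 1 \<le> M s * exp (C s - t)"
        using True m(2) s by (intro mult_left_mono) auto
      then show ?thesis
        using m(3)[of t] True \<open>t \<ge> 0\<close> \<sigma>_nonneg unfolding s_def[symmetric] by simp
    next
      case False
      \<comment> \<open>Entry occurs by time \<open>C s\<close> in a state of norm at most
        \<open>M s\<close>. Hence \<open>max 0 (t - C s)\<close> underestimates the time since entry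
        and \<open>s + M s\<close> overestimates the norm at entry, both of which only increase
        \<sigma>.\<close>
      have "norm (x (?\<tau> m)) \<le> M s"
        using m(3) sample_time_nonneg[OF period(1)] by simp
      then have "\<sigma> (norm (x (?\<tau> m))) (t - ?\<tau> m) \<le> \<sigma> (s + M s) (max 0 (t - C s))"
        using s False m(2) by (intro class_KL_mono[OF KL]) auto
      moreover have "0 \<le> M s * exp (C s - t)"
        using s by simp
      ultimately show ?thesis
        using bound_after_entry[OF x d e m(1), of t] False unfolding s_def[symmetric] by linarith
    qed
  qed
  then show ?thesis
    using class_KL_delayed[OF KL M C(1,2)] by (intro exI[of _ ?\<sigma>]) blast
qed

end

section \<open>Boundedness and growth of the feedback, and the conclusion\<close>

theorem theorem3p1:
  fixes f :: "real ^ 'l \<Rightarrow> real ^ 'n \<Rightarrow> real ^ 'm \<Rightarrow> real ^ 'n"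
    and D :: "(real ^ 'l) set" and U :: "(real ^ 'm) set" and \<Theta> :: "(real ^ 'n) set"
  assumes "D \<noteq> {}"
    and "H1 f D U"
    and "H2 f D U"
    and Theta: "bounded \<Theta>" "open \<Theta>" "\<exists>\<rho>>0. ball 0 \<rho> \<subseteq> \<Theta>"
    and P1: "\<exists>k. admissible_feedback f D U k \<and>
      (\<exists>h>0. \<exists>\<sigma>. class_KL \<sigma> \<and>
        (\<forall>x0\<in>\<Theta>. \<forall>d\<in>Linf_loc D. \<forall>e\<in>sampling_inputs.
           (\<exists>x. sampled_solution f d k h e x0 x) \<and>
           (\<forall>x. sampled_solution f d k h e x0 x \<longrightarrow>
              (\<forall>t\<ge>0. norm (x t) \<le> \<sigma> (norm x0) t \<and> x t \<in> \<Theta>))))"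
    and P2: "\<exists>r>0. \<exists>(N::nat) (\<Omega> :: nat \<Rightarrow> (real ^ 'n) set).
      \<Omega> 1 = \<Theta> \<and> (\<Union>j\<in>{1..N}. \<Omega> j) = UNIV \<and>
      (\<forall>j\<in>{2..N}. robustly_reachable f D U r (\<Union>i\<in>{1..j - 1}. \<Omega> i) (\<Omega> j))"
  shows "bounded_robustly_globally_stabilizable f D U"
proof -
  obtain k\<^sub>0 h\<^sub>0 \<sigma> where k0: "admissible_feedback f D U k\<^sub>0" and "0 < h\<^sub>0" and "class_KL \<sigma>"
    and local: "\<And>x0 d e. x0 \<in> \<Theta> \<Longrightarrow> d \<in> Linf_loc D \<Longrightarrow> e \<in> sampling_inputs \<Longrightarrow>
      (\<exists>x. sampled_solution f d k\<^sub>0 h\<^sub>0 e x0 x) \<and>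
      (\<forall>x. sampled_solution f d k\<^sub>0 h\<^sub>0 e x0 x \<longrightarrow> (\<forall>t\<ge>0. norm (x t) \<le> \<sigma> (norm x0) t \<and> x t \<in> \<Theta>))"
    using P1 by blast
  obtain r and N :: nat and \<Omega> where "0 < r" and \<Omega>: "\<Omega> 1 = \<Theta>" "(\<Union>j\<in>{1..N}. \<Omega> j) = UNIV"
    and rr: "\<forall>j\<in>{2..N}. robustly_reachable f D U r (\<Union>i\<in>{1..j - 1}. \<Omega> i) (\<Omega> j)"
    using P2 by blast
  \<comment> \<open>The body of reachability with its witnesses as arguments, so that the choice
    over \<open>j\<close> yields them as functions of the level.\<close>
  define R where "R j w c a b \<longleftrightarrow> w \<in> U \<and> 0 \<le> c \<and> class_N a \<and> class_N b \<and>
      (\<forall>x0\<in>\<Omega> j. \<forall>d\<in>Linf_loc D. \<exists>T. 0 \<le> T \<and> T \<le> c + b (norm x0) \<and>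
           (\<exists>x. x 0 = x0 \<and> solves_const f d w 0 (T + r) x) \<and>
           (\<forall>x. x 0 = x0 \<and> solves_const f d w 0 (T + r) x \<longrightarrow>
              (\<forall>t\<in>{0..T + r}. norm (x t) \<le> a (norm x0)) \<and>
              (\<forall>t\<in>{T..T + r}. x t \<in> (\<Union>i\<in>{1..j - 1}. \<Omega> i)) \<and>
              (\<forall>t\<in>{0..T}. x t \<in> \<Omega> j)))" for j w c a b
  have "\<exists>w c a b. R j w c a b" if "j \<in> {2..N}" for j
    using bspec[OF rr that] unfolding robustly_reachable_def R_def Bex_def
    by (elim exE conjE) (rule exI, rule exI, rule exI, rule exI, intro conjI, assumption+)
  then obtain v c a b where vcab: "\<And>j. j \<in> {2..N} \<Longrightarrow> R j (v j) (c j) (a j) (b j)"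
    by metis
  interpret reachability_chain f D U k\<^sub>0 h\<^sub>0 \<sigma> r N \<Omega> v c a b
  proof unfold_locales
    show "range k\<^sub>0 \<subseteq> U"
      using k0 by (simp add: admissible_feedback_def)
    fix j assume "j \<in> {2..N}"
    note R = vcab[OF this, unfolded R_def]
    show "v j \<in> U" "0 \<le> c j" "class_N (a j)" "class_N (b j)"
      using R by - ((elim conjE, assumption)+)
    fix x0 d assume "x0 \<in> \<Omega> j" "d \<in> Linf_loc D"
    with R show "\<exists>T. 0 \<le> T \<and> T \<le> c j + b j (norm x0) \<and>
        (\<exists>x. x 0 = x0 \<and> solves_const f d (v j) 0 (T + r) x) \<and>
        (\<forall>x. x 0 = x0 \<and> solves_const f d (v j) 0 (T + r) x \<longrightarrow>
          (\<forall>t\<in>{0..T + r}. norm (x t) \<le> a j (norm x0)) \<and>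
          (\<forall>t\<in>{T..T + r}. x t \<in> (\<Union>i\<in>{1..j - 1}. \<Omega> i)) \<and>
          (\<forall>t\<in>{0..T}. x t \<in> \<Omega> j))"
      by (elim conjE) (drule bspec, assumption, drule bspec, assumption+)
  next
    fix x0 d e x t
    assume "x0 \<in> \<Omega> 1" "d \<in> Linf_loc D" "e \<in> sampling_inputs"
    note loc = local[OF this[unfolded \<Omega>(1)]]
    then show "\<exists>x. sampled_solution f d k\<^sub>0 h\<^sub>0 e x0 x"
      by blast
    assume "sampled_solution f d k\<^sub>0 h\<^sub>0 e x0 x" "(0::real) \<le> t"
    with loc show "norm (x t) \<le> \<sigma> (norm x0) t \<and> x t \<in> \<Omega> 1"
      unfolding \<Omega>(1) by blast
  qed (fact \<open>H1 f D U\<close> \<open>0 < h\<^sub>0\<close> \<open>class_KL \<sigma>\<close> \<open>0 < r\<close> \<Omega>(2))+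
  obtain \<rho> where \<rho>: "0 < \<rho>" "ball 0 \<rho> \<subseteq> \<Theta>"
    using Theta(3) by blast
  \<comment> \<open>As \<Theta> is bounded, its closure is compact and local boundedness applies.
    Outside \<Theta> the feedback takes finitely many values.\<close>
  have "bounded (k\<^sub>0 ` closure \<Theta>)"
    using k0 Theta(1) by (simp add: admissible_feedback_def locally_bounded_on_def)
  moreover have "range feedback \<subseteq> k\<^sub>0 ` closure \<Theta> \<union> v ` {2..N}"
    using level(1)[unfolded \<Omega>(1)] closure_subset[of \<Theta>] unfolding feedback_def \<Omega>(1) by force
  ultimately have bdd: "bounded (range feedback)"
    by (meson bounded_Un bounded_subset finite_imp_bounded finite_imageI finite_atLeastAtMost)
  then obtain V where V: "0 < V" "\<And>x. norm (feedback x) \<le> V"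
    unfolding bounded_pos by blast
  obtain \<gamma> where \<gamma>: "class_K_inf \<gamma>"
    "\<And>d z x. d \<in> D \<Longrightarrow> norm (f d z (k\<^sub>0 x)) \<le> \<gamma> (norm z + norm x)"
    using k0 unfolding admissible_feedback_def by blast
  obtain \<alpha> where \<alpha>: "class_K_inf \<alpha>"
    "\<And>u d x. u \<in> U \<Longrightarrow> d \<in> D \<Longrightarrow> norm (f d x u) \<le> \<alpha> (norm x + norm u)"
    using \<open>H2 f D U\<close> unfolding H2_def by blast
  have K: "class_K \<gamma>" "class_K \<alpha>"
    using \<gamma>(1) \<alpha>(1) by (simp_all add: class_K_inf_def)
  \<comment> \<open>Outside \<Theta> the norm of \<open>x\<close> is at least \<rho>, so the bound
    \<open>V\<close> on the control is at most \<open>V / \<rho> * norm x\<close>. The summand 1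
    accounts for \<open>norm z\<close>. This makes the bound from \<open>H2\<close> a function of
    \<open>norm z + norm x\<close> that vanishes at 0.\<close>
  define m where "m = 1 + V / \<rho>"
  have "0 < m"
    using V(1) \<rho>(1) by (simp add: m_def add_pos_pos)
  define \<kappa> where "\<kappa> s = \<gamma> s + \<alpha> (m * s)" for s
  have growth: "norm (f d z (feedback x)) \<le> \<kappa> (norm z + norm x)" if "d \<in> D" for d z x
  proof (cases "x \<in> \<Theta>")
    case True
    then have "norm (f d z (feedback x)) \<le> \<gamma> (norm z + norm x)"
      using \<gamma>(2)[OF that, of z x] unfolding feedback_def \<Omega>(1) by simp
    moreover have "0 \<le> \<alpha> (m * (norm z + norm x))"
      using \<open>0 < m\<close> by (intro class_K_nonneg[OF K(2)]) simp
    ultimately show ?thesis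
      by (simp add: \<kappa>_def)
  next
    case False
    then have "\<rho> \<le> norm x"
      using \<rho>(2) by (force simp: subset_iff)
    then have "V * \<rho> \<le> V * norm x"
      using V(1) by simp
    then have "V \<le> V / \<rho> * norm x"
      using \<rho>(1) by (simp add: field_simps)
    moreover have "0 \<le> V / \<rho> * norm z"
      using V(1) \<rho>(1) by simp
    ultimately have "norm z + norm (feedback x) \<le> m * (norm z + norm x)"
      using V(2)[of x] norm_ge_zero[of x] unfolding m_def distrib_left distrib_right mult_1 by linarith
    then have "\<alpha> (norm z + norm (feedback x)) \<le> \<alpha> (m * (norm z + norm x))"
      by (intro class_K_mono[OF K(2)]) simp_all
    moreover have "norm (f d z (feedback x)) \<le> \<alpha> (norm z + norm (feedback x))"
      by (rule \<alpha>(2)[OF feedback_U that])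
    moreover have "0 \<le> \<gamma> (norm z + norm x)"
      by (intro class_K_nonneg[OF K(1)]) simp
    ultimately show ?thesis
      by (simp add: \<kappa>_def)
  qed
  have "admissible_feedback f D U feedback"
    unfolding admissible_feedback_def
  proof (intro conjI)
    show "range feedback \<subseteq> U"
      using feedback_U by blast
    show "locally_bounded_on UNIV feedback"
      using bdd unfolding locally_bounded_on_def by (meson bounded_subset image_mono subset_UNIV)
    have "0 \<in> \<Theta>"
      using \<rho> by auto
    then show "feedback 0 = 0"
      using k0 unfolding feedback_def \<Omega>(1) admissible_feedback_def by simp
    show "\<exists>\<kappa>. class_K_inf \<kappa> \<and> (\<forall>d\<in>D. \<forall>z x. norm (f d z (feedback x)) \<le> \<kappa> (norm z + norm x))"
      using class_K_inf_add_scaled[OF \<gamma>(1) K(2) \<open>0 < m\<close>] growth unfolding \<kappa>_def by blast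
  qed
  then have "globally_stabilizing_feedback f D U feedback"
    unfolding globally_stabilizing_feedback_def
    using feedback_KL_bound feedback_solution_exists period(1) by blast
  then show ?thesis
    using bdd unfolding bounded_robustly_globally_stabilizable_def by blast
qed

end
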